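(* Let $N\ge1$, let $a_1,\dots,a_N\in\mathbb R$ with $0<|a_i|<1$, and let $\sigma(x,y)$, $q_r$, $\tilde q_t$ be as defined in the context. For $n,t\ge 2N$ and $n-N<l\le n$, let $\tilde p^l_{n,t}(x,y)$ be the polynomial of norm one, of reverse lexicographical degree $(l,t)$ (with positive leading coefficient), orthogonal with respect to $\sigma(x,y)\,dx\,dy$ to all monomials in $\Pi_{n,m}$ (where $m\ge t$) of reverse lexicographical degree less than $(l,t)$. Then there exist constants $\tilde a_{n-l,j}$, $\tilde b_{n-l,j}$, $j=0,\dots,l-(n-N)-1$ (depending on $n,t,l$ only through $n-l$), such that $$\tilde p^l_{n,t}(x,y)=\sum_{j=0}^{l-(n-N)-1}\left\{\tilde a_{n-l,j}\,\tilde q_{t+j}(x,y)U_{l-j}(x)+\tilde b_{n-l,j}\,q_{n+1+j}(x,y)U_{t+l-n-1-j}(y)\right\}.$$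
   Context: Write $x=\frac12(z+1/z)$, $y=\frac12(w+1/w)$. Set $\omega(z,w)=\prod_{i=1}^N(1+a_izw)$, $$h(z,y)=\omega(z,w)\omega(z,1/w)=\sum_{i=0}^{2N}h_i(y)z^i,\qquad \tilde h(x,w)=\omega(z,w)\omega(1/z,w)=\sum_{j=0}^{2N}\tilde h_j(x)w^j,$$ where the $h_i$ are polynomials in $y$ and the $\tilde h_j$ polynomials in $x$. The weight on $[-1,1]^2$ is $$\sigma(x,y)=\frac{4}{\pi^2}\frac{\sqrt{1-x^2}\sqrt{1-y^2}}{|h(z,y)|^2}=\frac{4}{\pi^2}\frac{\sqrt{1-x^2}\sqrt{1-y^2}}{|\tilde h(x,w)|^2},\qquad |z|=|w|=1.$$ $U_n$ is the Chebyshev polynomial of the second kind, with $U_n=-U_{-n-2}$ for $n<0$. Define $q_r(x,y)=\sum_{i=0}^{2N}h_i(y)U_{r-i}(x)$ and $\tilde q_t(x,y)=\sum_{j=0}^{2N}\tilde h_j(x)U_{t-j}(y)$. $\Pi_{n,m}=\mathrm{span}\{x^iy^j:0\le i\le n,\ 0\le j\le m\}$. Reverse lexicographical ordering: $(i,j)<_{\rm revlex}(i_1,j_1)$ iff $j<j_1$, or $j=j_1$ and $i<i_1$. An element of $\Pi_{n,m}$ has reverse lexicographical degree $(l,t)$ if $x^ly^t$ is the revlex-largest monomial $x^iy^j$ occurring in it with nonzero coefficient; its leading coefficient is the coefficient of that monomial. Norm one means $\int p^2\sigma\,dx\,dy=1$. $\tilde p^l_{n,t}$ belongs to $\Pi_{n,m}$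 (and does not depend on $m\ge t$). *)

theory Defs
  imports "HOL-Analysis.Analysis"
begin

definition omega :: "nat \<Rightarrow> (nat \<Rightarrow> real) \<Rightarrow> complex \<Rightarrow> complex \<Rightarrow> complex" where
  "omega N a z w = (\<Prod>i = 1..N. 1 + complex_of_real (a i) * z * w)"

abbreviation cpoly :: "real poly \<Rightarrow> complex \<Rightarrow> complex" where
  "cpoly p \<equiv> poly (map_poly complex_of_real p)"

(* The polynomials h_i(y), determined by the expansion of h(z,y) with y = (w + 1/w)/2.
   Existence and uniqueness are proved below, as h_coeff_expansion and h_coeff_unique. *)
definition h_coeff :: "nat \<Rightarrow> (nat \<Rightarrow> real) \<Rightarrow> nat \<Rightarrow> real poly" where
  "h_coeff N a = (THE h. (\<forall>i > 2 * N. h i = 0) \<and>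
     (\<forall>z w. w \<noteq> 0 \<longrightarrow>
        omega N a z w * omega N a z (1 / w) = (\<Sum>i = 0..2 * N. cpoly (h i) ((w + 1 / w) / 2) * z ^ i)))"

definition ht_coeff :: "nat \<Rightarrow> (nat \<Rightarrow> real) \<Rightarrow> nat \<Rightarrow> real poly" where
  "ht_coeff N a = (THE h. (\<forall>j > 2 * N. h j = 0) \<and>
     (\<forall>z w. z \<noteq> 0 \<longrightarrow>
        omega N a z w * omega N a (1 / z) w = (\<Sum>j = 0..2 * N. cpoly (h j) ((z + 1 / z) / 2) * w ^ j)))"

(* For x, y in [-1,1] the numbers z = x + i sqrt(1 - x^2) and w = y + i sqrt(1 - y^2) lie on the
   unit circle and satisfy x = (z + 1/z)/2, y = (w + 1/w)/2; by weight_unit_circle below, the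
   other choices (complex conjugates) and the expression through omega(z,w) omega(1/z,w) give
   the same value. *)
definition weight :: "nat \<Rightarrow> (nat \<Rightarrow> real) \<Rightarrow> real \<Rightarrow> real \<Rightarrow> real" where
  "weight N a x y =
     (let z = Complex x (sqrt (1 - x\<^sup>2)); w = Complex y (sqrt (1 - y\<^sup>2))
      in 4 / pi\<^sup>2 * (sqrt (1 - x\<^sup>2) * sqrt (1 - y\<^sup>2)) / (cmod (omega N a z w * omega N a z (1 / w)))\<^sup>2)"

fun cheb_U_nat :: "nat \<Rightarrow> real \<Rightarrow> real" where
  "cheb_U_nat 0 x = 1"
| "cheb_U_nat (Suc 0) x = 2 * x"
| "cheb_U_nat (Suc (Suc n)) x = 2 * x * cheb_U_nat (Suc n) x - cheb_U_nat n x"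

(* The extension U_n = - U_{-n-2} to n < 0; for n = -1 this forces the value 0. *)
definition cheb_U :: "int \<Rightarrow> real \<Rightarrow> real" where
  "cheb_U n x = (if n \<ge> 0 then cheb_U_nat (nat n) x else if n = -1 then 0 else - cheb_U_nat (nat (- n - 2)) x)"

definition q_poly :: "nat \<Rightarrow> (nat \<Rightarrow> real) \<Rightarrow> int \<Rightarrow> real \<Rightarrow> real \<Rightarrow> real" where
  "q_poly N a r x y = (\<Sum>i = 0..2 * N. poly (h_coeff N a i) y * cheb_U (r - int i) x)"

definition qt_poly :: "nat \<Rightarrow> (nat \<Rightarrow> real) \<Rightarrow> int \<Rightarrow> real \<Rightarrow> real \<Rightarrow> real" where
  "qt_poly N a t x y = (\<Sum>j = 0..2 * N. poly (ht_coeff N a j) x * cheb_U (t - int j) y)"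

(* Bivariate polynomials are elements of R[x][y]: the outer variable is y, and coeff2 p i j is
   the coefficient of x^i y^j. *)
type_synonym poly2 = "real poly poly"

definition coeff2 :: "poly2 \<Rightarrow> nat \<Rightarrow> nat \<Rightarrow> real" where
  "coeff2 p i j = coeff (coeff p j) i"

definition eval2 :: "poly2 \<Rightarrow> real \<Rightarrow> real \<Rightarrow> real" where
  "eval2 p x y = poly (poly p [:y:]) x"

definition Pi_nm :: "nat \<Rightarrow> nat \<Rightarrow> poly2 set" where
  "Pi_nm n m = {p. \<forall>i j. coeff2 p i j \<noteq> 0 \<longrightarrow> i \<le> n \<and> j \<le> m}"

definition revlex_less :: "nat \<times> nat \<Rightarrow> nat \<times> nat \<Rightarrow> bool" where
  "revlex_less u v \<longleftrightarrow> snd u < snd v \<or> (snd u = snd v \<and> fst u < fst v)"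

definition has_revlex_degree :: "poly2 \<Rightarrow> nat \<times> nat \<Rightarrow> bool" where
  "has_revlex_degree p d \<longleftrightarrow> coeff2 p (fst d) (snd d) \<noteq> 0 \<and>
     (\<forall>i j. coeff2 p i j \<noteq> 0 \<longrightarrow> (i, j) = d \<or> revlex_less (i, j) d)"

definition weight_integral :: "nat \<Rightarrow> (nat \<Rightarrow> real) \<Rightarrow> (real \<Rightarrow> real \<Rightarrow> real) \<Rightarrow> real" where
  "weight_integral N a f =
     set_lebesgue_integral lborel ({-1..1} \<times> {-1..1}) (\<lambda>(x, y). f x y * weight N a x y)"

definition is_ptilde ::
  "nat \<Rightarrow> (nat \<Rightarrow> real) \<Rightarrow> nat \<Rightarrow> nat \<Rightarrow> nat \<Rightarrow> nat \<Rightarrow> poly2 \<Rightarrow> bool" where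
  "is_ptilde N a n m l t p \<longleftrightarrow>
     p \<in> Pi_nm n m \<and>
     has_revlex_degree p (l, t) \<and>
     coeff2 p l t > 0 \<and>
     weight_integral N a (\<lambda>x y. (eval2 p x y)\<^sup>2) = 1 \<and>
     (\<forall>i j. i \<le> n \<longrightarrow> j \<le> m \<longrightarrow> revlex_less (i, j) (l, t) \<longrightarrow>
        weight_integral N a (\<lambda>x y. eval2 p x y * (x ^ i * y ^ j)) = 0)"


lemma poly_sum_le:
  fixes p :: "'a :: comm_ring_1 poly"
  assumes "degree p \<le> m"
  shows "poly p x = (\<Sum>i\<le>m. coeff p i * x ^ i)"
  unfolding poly_altdef
  by (rule sum.mono_neutral_left) (use assms in \<open>auto simp: coeff_eq_0\<close>)

lemma eval2_coeff2:
  assumes "p \<in> Pi_nm n m"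
  shows "eval2 p x y = (\<Sum>j\<le>m. \<Sum>i\<le>n. coeff2 p i j * x ^ i * y ^ j)"
proof -
  have d1: "degree p \<le> m"
  proof (rule degree_le, intro allI impI)
    fix j assume "m < j"
    then show "coeff p j = 0"
      using assms by (fastforce simp: Pi_nm_def coeff2_def poly_eq_iff)
  qed
  have d2: "degree (coeff p j) \<le> n" for j
    by (rule degree_le) (use assms in \<open>fastforce simp: Pi_nm_def coeff2_def\<close>)
  have "eval2 p x y = (\<Sum>j\<le>m. poly (coeff p j) x * y ^ j)"
    by (simp add: eval2_def poly_sum_le[OF d1] poly_sum poly_power)
  also have "\<dots> = (\<Sum>j\<le>m. \<Sum>i\<le>n. coeff2 p i j * x ^ i * y ^ j)"
    by (simp add: poly_sum_le[OF d2] coeff2_def sum_distrib_right)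
  finally show ?thesis .
qed


lemma joukowski_surj:
  fixes Y :: complex
  obtains w where "w \<noteq> 0" "(w + 1 / w) / 2 = Y"
proof -
  define s where "s = csqrt (Y\<^sup>2 - 1)"
  have "(Y + s) * (Y - s) = 1"
    by (simp add: s_def algebra_simps flip: power2_eq_square)
  moreover from this have "Y + s \<noteq> 0" by auto
  ultimately have "1 / (Y + s) = Y - s" by (simp add: field_simps)
  with \<open>Y + s \<noteq> 0\<close> show ?thesis by (intro that[of "Y + s"]) auto
qed

lemma omega_mult_inverse_right:
  assumes "w \<noteq> 0"
  shows "omega N a z w * omega N a z (1 / w) =
    (\<Prod>i = 1..N. 1 + 2 * of_real (a i) * ((w + 1 / w) / 2) * z + (of_real (a i))\<^sup>2 * z\<^sup>2)"
proof -
  have "(1 + c * z * w) * (1 + c * z * (1 / w)) = 1 + 2 * c * ((w + 1 / w) / 2) * z + c\<^sup>2 * z\<^sup>2" for c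
  proof -
    have "(1 + c * z * w) * (1 + c * z * v) = 1 + 2 * c * ((w + v) / 2) * z + c\<^sup>2 * z\<^sup>2" if "w * v = 1" for v
    proof -
      have "(1 + c * z * w) * (1 + c * z * v) = 1 + c * z * (w + v) + c\<^sup>2 * z\<^sup>2 * (w * v)"
        by (simp add: algebra_simps power2_eq_square)
      with that show ?thesis by (simp add: mult_ac)
    qed
    from this[of "1 / w"] show ?thesis using assms by simp
  qed
  then show ?thesis
    unfolding omega_def prod.distrib[symmetric] by simp
qed

lemma omega_commute: "omega N a z w = omega N a w z"
  by (simp add: omega_def mult_ac)

lemma cpoly_pCons: "cpoly (pCons c p) y = of_real c + y * cpoly p y"
  by (simp add: map_poly_pCons)

lemma cpoly_add: "cpoly (p + r) y = cpoly p y + cpoly r y"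
  by (induction p r rule: poly_induct2) (simp_all add: cpoly_pCons algebra_simps)

lemma cpoly_smult: "cpoly (smult c p) y = of_real c * cpoly p y"
  by (induction p) (simp_all add: cpoly_pCons algebra_simps)

lemma expansion_exists:
  fixes a :: "nat \<Rightarrow> real"
  shows "\<exists>h. (\<forall>i > 2 * N. h i = 0) \<and>
     (\<forall>z y. (\<Prod>i = 1..N. 1 + 2 * of_real (a i) * y * z + (of_real (a i))\<^sup>2 * z\<^sup>2) =
        (\<Sum>i = 0..2 * N. cpoly (h i) y * z ^ i))"
proof (induction N)
  case 0
  show ?case by (intro exI[of _ "\<lambda>i. if i = 0 then 1 else 0"]) auto
next
  case (Suc N)
  then obtain h where h0: "\<And>i. i > 2 * N \<Longrightarrow> h i = 0" and
    h: "\<And>z y. (\<Prod>i = 1..N. 1 + 2 * of_real (a i) * y * z + (of_real (a i))\<^sup>2 * z\<^sup>2) =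
        (\<Sum>i = 0..2 * N. cpoly (h i) y * z ^ i)" by blast
  define c where "c = a (Suc N)"
  define g where "g i = h i + (if i \<ge> 1 then smult (2 * c) (pCons 0 (h (i - 1))) else 0)
                            + (if i \<ge> 2 then smult (c\<^sup>2) (h (i - 2)) else 0)" for i
  have "(\<Prod>i = 1..Suc N. 1 + 2 * of_real (a i) * y * z + (of_real (a i))\<^sup>2 * z\<^sup>2) =
        (\<Sum>i = 0..2 * Suc N. cpoly (g i) y * z ^ i)" for z y
  proof -
    define F where "F i = cpoly (h i) y" for i
    have F0: "F i = 0" if "i > 2 * N" for i using h0[OF that] by (simp add: F_def)
    define k where "k = 2 * of_real c * y"
    define k2 where "k2 = (of_real c :: complex)\<^sup>2"
    define S where "S = (\<Sum>i = 0..2 * N. F i * z ^ i)"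
    have G: "cpoly (g i) y = F i + (if i \<ge> 1 then k * F (i - 1) else 0) + (if i \<ge> 2 then k2 * F (i - 2) else 0)" for i
      by (simp add: g_def cpoly_add cpoly_smult cpoly_pCons F_def k_def k2_def)
    have s0: "(\<Sum>i = 0..Suc (Suc (2 * N)). F i * z ^ i) = S"
      and s1': "(\<Sum>i = 0..Suc (2 * N). F i * z ^ i) = S"
      by (simp_all add: F0 S_def)
    have s1: "(\<Sum>i = 0..Suc (Suc (2 * N)). (if i \<ge> 1 then k * F (i - 1) else 0) * z ^ i) = k * z * S"
      unfolding s1'[symmetric] sum.atLeast0_atMost_Suc_shift sum_distrib_left
      by (simp add: mult_ac distrib_left sum_distrib_left del: sum.cl_ivl_Suc)
    have s2: "(\<Sum>i = 0..Suc (Suc (2 * N)). (if i \<ge> 2 then k2 * F (i - 2) else 0) * z ^ i) = k2 * z\<^sup>2 * S"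
      unfolding S_def sum.atLeast0_atMost_Suc_shift sum_distrib_left
      by (simp add: mult_ac power2_eq_square sum_distrib_left del: sum.cl_ivl_Suc)
    have "(\<Sum>i = 0..2 * Suc N. cpoly (g i) y * z ^ i) = S + k * z * S + k2 * z\<^sup>2 * S"
      by (simp only: G s0 s1 s2 distrib_right sum.distrib mult_Suc_right add_2_eq_Suc)
    also have "\<dots> = S * (1 + 2 * of_real c * y * z + (of_real c)\<^sup>2 * z\<^sup>2)"
      by (simp add: k_def k2_def algebra_simps)
    also have "S = (\<Prod>i = 1..N. 1 + 2 * of_real (a i) * y * z + (of_real (a i))\<^sup>2 * z\<^sup>2)"
      by (simp only: h S_def F_def)
    finally show ?thesis
      by (simp add: c_def del: sum.cl_ivl_Suc)
  qed
  moreover have "\<forall>i > 2 * Suc N. g i = 0"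
    by (auto simp: g_def h0)
  ultimately show ?case by blast
qed


lemma expansion_unique:
  assumes f0: "\<And>i. i > 2 * N \<Longrightarrow> f i = 0" and g0: "\<And>i. i > 2 * N \<Longrightarrow> g i = 0"
    and eq: "\<And>z y. (\<Sum>i = 0..2 * N. cpoly (f i) y * z ^ i) = (\<Sum>i = 0..2 * N. cpoly (g i) y * z ^ i)"
  shows "f = g"
proof
  fix i
  have "cpoly (f i) y = cpoly (g i) y" for y
  proof (cases "i \<le> 2 * N")
    case True
    have "\<forall>i\<le>2 * N. cpoly (f i) y = cpoly (g i) y"
      by (subst polyfun_eq_coeffs[symmetric]) (use eq in \<open>simp add: atLeast0AtMost\<close>)
    with True show ?thesis by blast
  qed (use f0 g0 in auto)
  then have "map_poly complex_of_real (f i) = map_poly complex_of_real (g i)"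
    by (intro iffD1[OF poly_eq_poly_eq_iff] ext)
  then show "f i = g i"
    by (auto simp: poly_eq_iff coeff_map_poly)
qed

lemma h_coeff_ex1:
  "\<exists>!h. (\<forall>i > 2 * N. h i = 0) \<and> (\<forall>z w. w \<noteq> 0 \<longrightarrow>
     omega N a z w * omega N a z (1 / w) = (\<Sum>i = 0..2 * N. cpoly (h i) ((w + 1 / w) / 2) * z ^ i))"
  (is "\<exists>!h. ?Z h \<and> ?E h")
proof (rule ex_ex1I)
  show "\<exists>h. ?Z h \<and> ?E h"
  proof -
    obtain h where h: "?Z h" "\<And>z y. (\<Prod>i = 1..N. 1 + 2 * of_real (a i) * y * z + (of_real (a i))\<^sup>2 * z\<^sup>2) =
        (\<Sum>i = 0..2 * N. cpoly (h i) y * z ^ i)"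
      using expansion_exists[of N a] by blast
    have "?E h"
      by (intro allI impI) (simp only: omega_mult_inverse_right h(2) not_False_eq_True)
    with h(1) show ?thesis by blast
  qed
next
  fix f g assume fg: "?Z f \<and> ?E f" "?Z g \<and> ?E g"
  show "f = g"
  proof (rule expansion_unique[of N])
    fix z y :: complex
    obtain w where "w \<noteq> 0" "(w + 1 / w) / 2 = y" using joukowski_surj .
    moreover have "omega N a z w * omega N a z (1 / w) =
        (\<Sum>i = 0..2 * N. cpoly (f i) ((w + 1 / w) / 2) * z ^ i)"
      using fg(1) \<open>w \<noteq> 0\<close> by blast
    moreover have "omega N a z w * omega N a z (1 / w) =
        (\<Sum>i = 0..2 * N. cpoly (g i) ((w + 1 / w) / 2) * z ^ i)"
      using fg(2) \<open>w \<noteq> 0\<close> by blast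
    ultimately show "(\<Sum>i = 0..2 * N. cpoly (f i) y * z ^ i) = (\<Sum>i = 0..2 * N. cpoly (g i) y * z ^ i)"
      by simp
  qed (use fg in auto)
qed

lemma h_coeff_expansion:
  shows "i > 2 * N \<Longrightarrow> h_coeff N a i = 0"
    and "w \<noteq> 0 \<Longrightarrow> omega N a z w * omega N a z (1 / w) =
           (\<Sum>i = 0..2 * N. cpoly (h_coeff N a i) ((w + 1 / w) / 2) * z ^ i)"
  using theI'[OF h_coeff_ex1[of N a]] unfolding h_coeff_def[symmetric] by blast+

lemma h_coeff_unique:
  assumes "\<And>i. i > 2 * N \<Longrightarrow> h i = 0"
    and "\<And>z w. w \<noteq> 0 \<Longrightarrow> omega N a z w * omega N a z (1 / w) =
           (\<Sum>i = 0..2 * N. cpoly (h i) ((w + 1 / w) / 2) * z ^ i)"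
  shows "h = h_coeff N a"
  unfolding h_coeff_def by (rule sym, rule the1_equality[OF h_coeff_ex1]) (use assms in blast)

(* omega is symmetric in its arguments, so h_i and ht_i coincide as polynomials in one variable. *)
lemma ht_coeff_eq_h_coeff: "ht_coeff N a = h_coeff N a"
  unfolding ht_coeff_def h_coeff_def
  by (rule arg_cong[where f = The], rule ext) (subst all_comm, simp add: omega_commute)

lemma cmod_omega_cnj:
  "cmod (omega N a (cnj z) (cnj w)) = cmod (omega N a z w)"
proof -
  have "omega N a (cnj z) (cnj w) = cnj (omega N a z w)" by (simp add: omega_def)
  then show ?thesis by simp
qed

lemma unit_circle_inverse: "cmod z = 1 \<Longrightarrow> 1 / z = cnj z"
  by (simp add: divide_conv_cnj)

lemma weight_unit_circle:
  assumes "cmod z = 1" "cmod w = 1"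
  shows "weight N a (Re z) (Re w) = 4 / pi\<^sup>2 * (sqrt (1 - (Re z)\<^sup>2) * sqrt (1 - (Re w)\<^sup>2))
           / (cmod (omega N a z w * omega N a z (1 / w)))\<^sup>2"
    and "weight N a (Re z) (Re w) = 4 / pi\<^sup>2 * (sqrt (1 - (Re z)\<^sup>2) * sqrt (1 - (Re w)\<^sup>2))
           / (cmod (omega N a z w * omega N a (1 / z) w))\<^sup>2"
proof -
  define F where "F u v = cmod (omega N a u v) * cmod (omega N a u (cnj v))" for u v
  have F1: "F u (cnj v) = F u v" for u v by (simp add: F_def)
  have F2: "F (cnj u) v = F u v" for u v
    using cmod_omega_cnj[of N a u v] cmod_omega_cnj[of N a u "cnj v"] by (simp add: F_def)
  have up: "Complex (Re u) (sqrt (1 - (Re u)\<^sup>2)) \<in> {u, cnj u}" if "cmod u = 1" for u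
  proof -
    have "(Re u)\<^sup>2 + (Im u)\<^sup>2 = 1" using that by (simp add: cmod_def)
    then have "1 - (Re u)\<^sup>2 = (Im u)\<^sup>2" by simp
    then have "sqrt (1 - (Re u)\<^sup>2) = \<bar>Im u\<bar>" by simp
    then show ?thesis by (auto simp: complex_eq_iff abs_if)
  qed
  define z' where "z' = Complex (Re z) (sqrt (1 - (Re z)\<^sup>2))"
  define w' where "w' = Complex (Re w) (sqrt (1 - (Re w)\<^sup>2))"
  have zw: "z' \<in> {z, cnj z}" "w' \<in> {w, cnj w}" using up assms by (auto simp: z'_def w'_def)
  then have "cmod w' = 1" using assms by auto
  then have "cmod (omega N a z' w' * omega N a z' (1 / w')) = F z' w'"
    by (simp add: F_def norm_mult unit_circle_inverse)
  also have "\<dots> = F z w" using zw F1 F2 by auto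
  finally have *: "cmod (omega N a z' w' * omega N a z' (1 / w')) = F z w" .
  have "F z w = cmod (omega N a z w * omega N a z (1 / w))"
    using assms by (simp add: F_def norm_mult unit_circle_inverse)
  moreover have "F z w = cmod (omega N a z w * omega N a (1 / z) w)"
    using assms cmod_omega_cnj[of N a z "cnj w"] by (simp add: F_def norm_mult unit_circle_inverse)
  ultimately show "weight N a (Re z) (Re w) = 4 / pi\<^sup>2 * (sqrt (1 - (Re z)\<^sup>2) * sqrt (1 - (Re w)\<^sup>2))
           / (cmod (omega N a z w * omega N a z (1 / w)))\<^sup>2"
    and "weight N a (Re z) (Re w) = 4 / pi\<^sup>2 * (sqrt (1 - (Re z)\<^sup>2) * sqrt (1 - (Re w)\<^sup>2))
           / (cmod (omega N a z w * omega N a (1 / z) w))\<^sup>2"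
    using * by (simp_all add: weight_def Let_def z'_def w'_def)
qed

end

theory Submission
  imports Defs "HOL-Complex_Analysis.Complex_Analysis"
begin

text \<open>
  Write \<open>d = n - l\<close>, \<open>k = N - d\<close> and \<open>\<omega>(z,w) = \<phi>(zw)\<close>, where \<open>\<phi>(s) = (1 + a\<^sub>1 s) \<dots> (1 + a\<^sub>N s)\<close> has
  coefficients \<open>c\<^sub>b\<close>. For fixed \<open>y\<close>, Cauchy's formula for \<open>z\<^sup>r\<^sup>+\<^sup>1 / h(z,y)\<close>, which is holomorphic on the
  closed unit disc, shows that \<open>q\<^sub>r\<close> is orthogonal in \<open>x\<close> to \<open>x\<^sup>i\<close> for \<open>i < r\<close>; symmetrically for
  \<open>q\<close>-tilde. Hence every sum of the required form, whatever its constants \<open>A\<^sub>j\<close>, \<open>B\<^sub>j\<close>, is orthogonal to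
  all monomials below \<open>(l,t)\<close> in \<open>\<Pi>\<^sub>n\<^sub>,\<^sub>m\<close>, and the only issue is its degree.

  Expanding the products of \<open>q\<close> with a Chebyshev polynomial, the sum becomes a combination of
  \<open>U\<^sub>l\<^sub>-\<^sub>b\<^sub>+\<^sub>e(x) U\<^sub>t\<^sub>-\<^sub>b\<^sub>-\<^sub>e(y)\<close> with weights \<open>c\<^sub>b g\<^sub>e\<close>, where \<open>s\<^sup>k\<^sup>-\<^sup>1\<close> times the Laurent polynomial with
  coefficients \<open>g\<^sub>e\<close> equals \<open>P(s) \<phi>(s) + Q(s) s\<^sup>N \<phi>(1/s)\<close>, for polynomials \<open>P\<close>, \<open>Q\<close> of degree below \<open>k\<close>
  whose coefficients are the constants. The degree is right as soon as \<open>g\<^sub>e = 0\<close> outside \<open>0 \<le> e \<le> d\<close>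
  and \<open>g\<^sub>0 \<noteq> 0\<close>. The former are \<open>2k - 1\<close> linear equations in \<open>2k\<close> unknowns. A nontrivial solution has
  \<open>g \<noteq> 0\<close> because \<open>\<phi>\<close> and its reciprocal polynomial are coprime, and \<open>g\<^sub>0 \<noteq> 0\<close> since otherwise the sum
  would be orthogonal to itself. Its squared norm is \<open>g\<^sub>0 A\<^sub>0\<close>, which depends on \<open>d\<close> only.
\<close>

section \<open>Chebyshev expansions\<close>

fun cheb_poly :: "nat \<Rightarrow> real poly" where
  "cheb_poly 0 = 1"
| "cheb_poly (Suc 0) = [:0, 2:]"
| "cheb_poly (Suc (Suc n)) = [:0, 2:] * cheb_poly (Suc n) - cheb_poly n"

lemma poly_cheb_poly: "poly (cheb_poly n) x = cheb_U_nat n x"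
  by (induction n rule: cheb_poly.induct) auto

lemma cheb_poly_degree_lead: "degree (cheb_poly n) \<le> n \<and> coeff (cheb_poly n) n = 2 ^ n"
proof (induction n rule: cheb_poly.induct)
  case (3 n)
  have "degree ([:0, 2:] * cheb_poly (Suc n)) \<le> Suc (Suc n)"
    by (rule order_trans[OF degree_mult_le]) (use 3 in auto)
  then have "degree (cheb_poly (Suc (Suc n))) \<le> Suc (Suc n)"
    using 3 by (auto intro!: degree_diff_le)
  moreover have "coeff (cheb_poly n) (Suc (Suc n)) = 0"
    by (rule coeff_eq_0) (use 3 in auto)
  ultimately show ?case using 3 by simp
qed auto

lemma degree_cheb_poly: "degree (cheb_poly n) \<le> n"
  and coeff_cheb_poly_top: "coeff (cheb_poly n) n = 2 ^ n"
  using cheb_poly_degree_lead by auto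

lemma coeff_cheb_poly_above: "n < i \<Longrightarrow> coeff (cheb_poly n) i = 0"
  using degree_cheb_poly[of n] by (intro coeff_eq_0) auto

lemma cheb_U_poly_ex: "\<exists>u. \<forall>x. cheb_U k x = poly u x"
proof -
  have "\<forall>x. cheb_U k x = poly (if k \<ge> 0 then cheb_poly (nat k) else if k = -1 then 0 else - cheb_poly (nat (- k - 2))) x"
    by (simp add: cheb_U_def poly_cheb_poly)
  then show ?thesis by blast
qed

lemma sin_cheb_U_nat: "sin \<theta> * cheb_U_nat n (cos \<theta>) = sin (of_nat (Suc n) * \<theta>)"
proof (induction n rule: cheb_poly.induct)
  case 2
  then show ?case using sin_double[of \<theta>] by simp
next
  case (3 n)
  have "sin \<theta> * cheb_U_nat (Suc (Suc n)) (cos \<theta>) =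
      2 * cos \<theta> * (sin \<theta> * cheb_U_nat (Suc n) (cos \<theta>)) - sin \<theta> * cheb_U_nat n (cos \<theta>)"
    by (simp add: algebra_simps)
  also have "\<dots> = 2 * cos \<theta> * sin (of_nat (Suc (Suc n)) * \<theta>) - sin (of_nat (Suc n) * \<theta>)"
    by (simp only: 3)
  also have "sin (of_nat (Suc n) * \<theta>) = sin (of_nat (Suc (Suc n)) * \<theta>) * cos \<theta> - cos (of_nat (Suc (Suc n)) * \<theta>) * sin \<theta>"
    by (subst sin_diff[symmetric]) (simp add: algebra_simps)
  also have "2 * cos \<theta> * sin (of_nat (Suc (Suc n)) * \<theta>) - \<dots> = sin (of_nat (Suc (Suc n)) * \<theta> + \<theta>)"
    by (subst sin_add) (simp add: algebra_simps)
  finally show ?case by (simp add: algebra_simps)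
qed auto

text \<open>Oddness of the sine matches the convention for negative indices, so one formula covers
  every integer \<open>k\<close> and the expansions below need no case distinction on signs.\<close>

lemma sin_cheb_U: "sin \<theta> * cheb_U k (cos \<theta>) = sin (of_int (k + 1) * \<theta>)"
proof -
  consider "k \<ge> 0" | "k = -1" | "k \<le> -2" by linarith
  then show ?thesis
  proof cases
    case 1
    then show ?thesis using sin_cheb_U_nat[of \<theta> "nat k"] by (simp add: cheb_U_def add.commute)
  next
    case 3
    then have "sin \<theta> * cheb_U k (cos \<theta>) = - sin (of_nat (Suc (nat (- k - 2))) * \<theta>)"
      using sin_cheb_U_nat[of \<theta> "nat (-k-2)"] by (simp add: cheb_U_def)
    also have "of_nat (Suc (nat (- k - 2))) * \<theta> = - (of_int (k + 1) * \<theta>)"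
      using 3 by (simp add: algebra_simps)
    finally show ?thesis by (simp only: sin_minus minus_minus)
  qed (simp add: cheb_U_def)
qed

text \<open>The values \<open>cos \<theta>\<close> with nonzero sine fill the infinite set
  \<open>(-1,1)\<close>. Polynomial identities can therefore be checked after multiplication by
  \<open>sin \<theta>\<close>.\<close>

lemma poly_eq_if_eq_on_cos:
  fixes p q :: "real poly"
  assumes "\<And>\<theta>. sin \<theta> \<noteq> 0 \<Longrightarrow> poly p (cos \<theta>) = poly q (cos \<theta>)"
  shows "p = q"
proof -
  have "poly p x = poly q x" if "x \<in> {-1<..<1}" for x
    using assms[of "arccos x"] that cos_arccos[of x] sin_arccos_nonzero[of x] by auto
  then have "{-1<..<1} \<subseteq> {x. poly (p - q) x = 0}" by auto
  moreover have "infinite {-1<..<1::real}" by simp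
  ultimately have "p - q = 0" using poly_roots_finite finite_subset by blast
  then show ?thesis by simp
qed

section \<open>The polynomial \<open>phi\<close> and the products of \<open>q_poly\<close> with
  \<open>cheb_U\<close>\<close>

definition phi :: "nat \<Rightarrow> (nat \<Rightarrow> real) \<Rightarrow> real poly" where
  "phi N a = (\<Prod>i = 1..N. [:1, a i:])"

lemma degree_phi: "degree (phi N a) \<le> N"
proof -
  have "degree (phi N a) \<le> (\<Sum>i=1..N. degree [:1, a i:])"
    unfolding phi_def using degree_prod_sum_le[of "{1..N}" "\<lambda>i. [:1, a i:]"] by (simp add: comp_def del: degree_pCons_eq_if)
  also have "\<dots> \<le> (\<Sum>i=1..N. 1)" by (intro sum_mono) simp
  finally show ?thesis by simp
qed

lemma coeff_phi_0: "coeff (phi N a) 0 = 1"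
  unfolding poly_0_coeff_0[symmetric] by (simp add: phi_def poly_prod)

lemma omega_phi: "omega N a z w = (\<Sum>b\<le>N. of_real (coeff (phi N a) b) * (z * w) ^ b)"
proof -
  have "omega N a z w = cpoly (phi N a) (z * w)"
  proof -
    have "cpoly (p * q) s = cpoly p s * cpoly q s" for p q s
      by (induction p) (simp_all add: cpoly_pCons cpoly_add cpoly_smult algebra_simps)
    then show ?thesis
      unfolding phi_def omega_def by (induction N) (simp_all add: cpoly_pCons cpoly_add cpoly_smult algebra_simps)
  qed
  also have "\<dots> = (\<Sum>b\<le>N. of_real (coeff (phi N a) b) * (z * w) ^ b)"
    using degree_phi[of N a] by (subst poly_sum_le[of _ N]) (simp_all add: degree_map_poly coeff_map_poly)
  finally show ?thesis .
qed

text \<open>At \<open>w = cis \<psi>\<close>, multiplying out \<open>phi(z w) phi(z / w)\<close>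
  gives terms \<open>z^(b+c) w^(b-c)\<close>; the formula follows by comparing coefficients of
  \<open>z^i\<close>.\<close>

lemma h_coeff_cis:
  "of_real (poly (h_coeff N a i) (cos \<psi>)) =
     (\<Sum>b\<le>N. \<Sum>c\<le>N. if b + c = i
        then of_real (coeff (phi N a) b * coeff (phi N a) c) * cis (of_int (int b - int c) * \<psi>) else 0)"
  (is "_ = ?R i")
proof -
  let ?c = "\<lambda>b. complex_of_real (coeff (phi N a) b)"
  have cn: "cis \<psi> \<noteq> 0" by simp
  have cc: "(cis \<psi> + 1 / cis \<psi>) / 2 = of_real (cos \<psi>)"
    by (simp add: cis_divide[of 0 \<psi>, simplified] complex_eq_iff)
  have cp: "cpoly p (of_real x) = of_real (poly p x)" for p x
    by (induction p) (simp_all add: cpoly_pCons)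
  have "(\<Sum>i\<le>2*N. of_real (poly (h_coeff N a i) (cos \<psi>)) * z ^ i) = (\<Sum>i\<le>2*N. ?R i * z ^ i)" for z
  proof -
    have "(\<Sum>i\<le>2*N. of_real (poly (h_coeff N a i) (cos \<psi>)) * z ^ i) = omega N a z (cis \<psi>) * omega N a z (1 / cis \<psi>)"
      by (simp only: h_coeff_expansion(2)[OF cn] cc cp atLeast0AtMost)
    also have "\<dots> = (\<Sum>b\<le>N. \<Sum>c\<le>N. ?c b * (z * cis \<psi>) ^ b * (?c c * (z / cis \<psi>) ^ c))"
      by (simp add: omega_phi sum_product)
    also have "\<dots> = (\<Sum>b\<le>N. \<Sum>c\<le>N. \<Sum>i\<le>2*N. if b + c = i then
        of_real (coeff (phi N a) b * coeff (phi N a) c) * cis (of_int (int b - int c) * \<psi>) * z ^ i else 0)"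
    proof (intro sum.cong refl)
      fix b c assume bc: "b \<in> {..N}" "c \<in> {..N}"
      have "cis \<psi> ^ b / cis \<psi> ^ c = cis (of_int (int b - int c) * \<psi>)"
        by (simp add: Complex.DeMoivre cis_divide algebra_simps)
      moreover have "?c b * (z * cis \<psi>) ^ b * (?c c * (z / cis \<psi>) ^ c) =
          of_real (coeff (phi N a) b * coeff (phi N a) c) * (cis \<psi> ^ b / cis \<psi> ^ c) * z ^ (b + c)"
        by (simp add: power_mult_distrib power_divide power_add)
      ultimately have "?c b * (z * cis \<psi>) ^ b * (?c c * (z / cis \<psi>) ^ c) =
          of_real (coeff (phi N a) b * coeff (phi N a) c) * cis (of_int (int b - int c) * \<psi>) * z ^ (b + c)"
        by (simp only:)
      then show "?c b * (z * cis \<psi>) ^ b * (?c c * (z / cis \<psi>) ^ c) = (\<Sum>i\<le>2*N. if b + c = i then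
        of_real (coeff (phi N a) b * coeff (phi N a) c) * cis (of_int (int b - int c) * \<psi>) * z ^ i else 0)"
        using bc by (subst sum.delta') auto
    qed
    also have "\<dots> = (\<Sum>i\<le>2*N. \<Sum>b\<le>N. \<Sum>c\<le>N. if b + c = i then
        of_real (coeff (phi N a) b * coeff (phi N a) c) * cis (of_int (int b - int c) * \<psi>) * z ^ i else 0)"
      by (subst sum.swap[of _ "{..2*N}" "{..N}"], subst sum.swap[of _ "{..2*N}" "{..N}"]) (rule refl)
    also have "\<dots> = (\<Sum>i\<le>2*N. ?R i * z ^ i)"
      unfolding sum_distrib_right by (intro sum.cong refl) auto
    finally show ?thesis .
  qed
  then have *: "\<forall>i\<le>2*N. of_real (poly (h_coeff N a i) (cos \<psi>)) = ?R i"
    by (subst polyfun_eq_coeffs[symmetric]) auto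
  show ?thesis
  proof (cases "i \<le> 2 * N")
    case False
    then have "?R i = 0" by (intro sum.neutral ballI) auto
    with False show ?thesis by (simp add: h_coeff_expansion(1))
  qed (use * in blast)
qed

text \<open>With \<open>y = cos \<psi>\<close>, each \<open>sin((s + 1 + b - c) \<psi>)\<close> is
  split by the addition theorem. The cosine parts sum to \<open>h_i\<close>; the sine parts cancel,
  because the condition \<open>b + c = i\<close> and the weights are symmetric in \<open>b\<close>
  and \<open>c\<close>.\<close>

lemma h_coeff_mult_cheb_U:
  "poly (h_coeff N a i) y * cheb_U s y =
     (\<Sum>b\<le>N. \<Sum>c\<le>N. if b + c = i
        then coeff (phi N a) b * coeff (phi N a) c * cheb_U (s + int b - int c) y else 0)"
proof -
  obtain u where u: "\<And>k x. cheb_U k x = poly (u k) x" using cheb_U_poly_ex by metis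
  let ?c = "\<lambda>b. coeff (phi N a) b"
  have "h_coeff N a i * u s = (\<Sum>b\<le>N. \<Sum>c\<le>N. if b + c = i then smult (?c b * ?c c) (u (s + int b - int c)) else 0)"
  proof (rule poly_eq_if_eq_on_cos)
    fix \<psi> :: real assume s0: "sin \<psi> \<noteq> 0"
    let ?e = "\<lambda>b c. of_int (int b - int c) * \<psi>"
    let ?S = "of_int (s + 1) * \<psi>"
    have "poly (h_coeff N a i) (cos \<psi>) = Re (of_real (poly (h_coeff N a i) (cos \<psi>)))" by simp
    also have "\<dots> = (\<Sum>b\<le>N. \<Sum>c\<le>N. if b + c = i then ?c b * ?c c * cos (?e b c) else 0)"
      unfolding h_coeff_cis Re_sum by (intro sum.cong refl) auto
    finally have H: "poly (h_coeff N a i) (cos \<psi>) = \<dots>" .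
    have "(\<Sum>b\<le>N. \<Sum>c\<le>N. if b + c = i then ?c b * ?c c * sin (?e b c) else 0) =
      (\<Sum>c\<le>N. \<Sum>b\<le>N. if b + c = i then ?c b * ?c c * sin (?e b c) else 0)" by (rule sum.swap)
    also have "\<dots> = - (\<Sum>b\<le>N. \<Sum>c\<le>N. if b + c = i then ?c b * ?c c * sin (?e b c) else 0)"
      unfolding sum_negf[symmetric]
    proof (intro sum.cong refl)
      fix b c
      have "sin (?e c b) = - sin (?e b c)" by (subst sin_minus[symmetric]) (simp add: algebra_simps)
      then show "(if c + b = i then ?c c * ?c b * sin (?e c b) else 0) = - (if b + c = i then ?c b * ?c c * sin (?e b c) else 0)"
        by (simp add: add.commute mult.commute)
    qed
    finally have Z: "(\<Sum>b\<le>N. \<Sum>c\<le>N. if b + c = i then ?c b * ?c c * sin (?e b c) else 0) = 0" by simp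
    have gen: "(if P then k * sin (S + E) else 0) =
        sin S * (if P then k * cos E else 0) + cos S * (if P then k * sin E else 0)" for P and k S E :: real
      by (simp add: sin_add algebra_simps)
    have "sin \<psi> * (\<Sum>b\<le>N. \<Sum>c\<le>N. if b + c = i then ?c b * ?c c * cheb_U (s + int b - int c) (cos \<psi>) else 0)
      = (\<Sum>b\<le>N. \<Sum>c\<le>N. if b + c = i then ?c b * ?c c * sin (?S + ?e b c) else 0)"
      unfolding sum_distrib_left
    proof (intro sum.cong refl)
      fix b c
      have "sin \<psi> * cheb_U (s + int b - int c) (cos \<psi>) = sin (?S + ?e b c)"
        unfolding sin_cheb_U by (simp add: algebra_simps)
      then show "sin \<psi> * (if b + c = i then ?c b * ?c c * cheb_U (s + int b - int c) (cos \<psi>) else 0) =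
        (if b + c = i then ?c b * ?c c * sin (?S + ?e b c) else 0)" by (simp add: mult_ac)
    qed
    also have "\<dots> = sin ?S * (\<Sum>b\<le>N. \<Sum>c\<le>N. if b + c = i then ?c b * ?c c * cos (?e b c) else 0)
       + cos ?S * (\<Sum>b\<le>N. \<Sum>c\<le>N. if b + c = i then ?c b * ?c c * sin (?e b c) else 0)"
      unfolding sum_distrib_left sum.distrib[symmetric]
      by (intro sum.cong refl gen)
    also have "\<dots> = sin \<psi> * (poly (h_coeff N a i) (cos \<psi>) * cheb_U s (cos \<psi>))"
      unfolding Z H[symmetric] sin_cheb_U[symmetric] by simp
    finally have "(\<Sum>b\<le>N. \<Sum>c\<le>N. if b + c = i then ?c b * ?c c * cheb_U (s + int b - int c) (cos \<psi>) else 0)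
       = poly (h_coeff N a i) (cos \<psi>) * cheb_U s (cos \<psi>)" using s0 by simp
    then show "poly (h_coeff N a i * u s) (cos \<psi>) = poly (\<Sum>b\<le>N. \<Sum>c\<le>N. if b + c = i then smult (?c b * ?c c) (u (s + int b - int c)) else 0) (cos \<psi>)"
      by (simp add: poly_sum u if_distrib[where f = "\<lambda>p. poly p _"] cong: if_cong)
  qed
  from arg_cong[OF this, of "\<lambda>p. poly p y"] show ?thesis
    by (simp add: poly_sum u if_distrib[where f = "\<lambda>p. poly p _"] cong: if_cong)
qed

text \<open>Every pair \<open>(b, c)\<close> has \<open>b + c \<le> 2 * N\<close> and occurs for
  exactly one \<open>i\<close>, so summing over \<open>i\<close> removes the constraint. In the
  result \<open>c\<close> lowers both indices while \<open>b\<close> moves them in opposite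
  directions, which the linear system exploits.\<close>

lemma q_poly_mult_cheb_U:
  "q_poly N a r x y * cheb_U s y =
     (\<Sum>b\<le>N. \<Sum>c\<le>N. coeff (phi N a) b * coeff (phi N a) c *
        (cheb_U (r - int b - int c) x * cheb_U (s + int b - int c) y))"
proof -
  let ?T = "\<lambda>b c. coeff (phi N a) b * coeff (phi N a) c * cheb_U (s + int b - int c) y"
  have "q_poly N a r x y * cheb_U s y =
      (\<Sum>i\<le>2*N. (poly (h_coeff N a i) y * cheb_U s y) * cheb_U (r - int i) x)"
    by (simp add: q_poly_def sum_distrib_right sum_distrib_left mult_ac atLeast0AtMost)
  also have "\<dots> = (\<Sum>i\<le>2*N. \<Sum>b\<le>N. \<Sum>c\<le>N. if b + c = i then ?T b c * cheb_U (r - int i) x else 0)"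
    unfolding h_coeff_mult_cheb_U sum_distrib_right by (intro sum.cong refl) auto
  also have "\<dots> = (\<Sum>b\<le>N. \<Sum>c\<le>N. \<Sum>i\<le>2*N. if b + c = i then ?T b c * cheb_U (r - int i) x else 0)"
    by (subst sum.swap[of _ "{..2*N}" "{..N}"], subst sum.swap[of _ "{..2*N}" "{..N}"]) (rule refl)
  also have "\<dots> = (\<Sum>b\<le>N. \<Sum>c\<le>N. ?T b c * cheb_U (r - int (b + c)) x)"
    by (intro sum.cong refl) (subst sum.delta', auto)
  finally show ?thesis by (simp add: algebra_simps)
qed

lemma qt_poly_eq_q_poly: "qt_poly N a t x y = q_poly N a t y x"
  by (simp add: qt_poly_def q_poly_def ht_coeff_eq_h_coeff)

section \<open>The linear system for the constants\<close>

text \<open>Gaussian elimination by induction on the equations: \<open>e\<close> is solved for an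
  unknown \<open>i0\<close> with nonzero coefficient and substituted into the others, leaving one
  equation and one unknown fewer.\<close>

lemma homogeneous_system_nontrivial:
  fixes f :: "'a \<Rightarrow> 'b \<Rightarrow> 'c :: field"
  assumes "finite J" "finite I" "card J < card I"
  shows "\<exists>v. (\<exists>i\<in>I. v i \<noteq> 0) \<and> (\<forall>e\<in>J. (\<Sum>i\<in>I. v i * f i e) = 0)"
  using assms
proof (induction J arbitrary: I f rule: finite_induct)
  case empty
  then have "I \<noteq> {}" by auto
  then show ?case by (intro exI[of _ "\<lambda>_. 1"]) auto
next
  case (insert e J)
  show ?case
  proof (cases "\<forall>i\<in>I. f i e = 0")
    case True
    have "card J < card I" using insert by simp
    then obtain v where "\<exists>i\<in>I. v i \<noteq> 0" "\<forall>e\<in>J. (\<Sum>i\<in>I. v i * f i e) = 0"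
      using insert.IH[of I f] insert.prems by blast
    with True show ?thesis by (intro exI[of _ v]) auto
  next
    case False
    then obtain i0 where i0: "i0 \<in> I" "f i0 e \<noteq> 0" by blast
    let ?I = "I - {i0}"
    have "card J < card ?I" using insert i0 by simp
    then obtain v where v: "\<exists>i\<in>?I. v i \<noteq> 0"
        "\<forall>e'\<in>J. (\<Sum>i\<in>?I. v i * (f i e' - f i e / f i0 e * f i0 e')) = 0"
      using insert.IH[of ?I "\<lambda>i e'. f i e' - f i e / f i0 e * f i0 e'"] insert.prems by blast
    define w where "w = v(i0 := - (\<Sum>i\<in>?I. v i * f i e) / f i0 e)"
    have split: "(\<Sum>i\<in>I. w i * f i e') =
        (\<Sum>i\<in>?I. v i * f i e') - (\<Sum>i\<in>?I. v i * f i e) / f i0 e * f i0 e'" for e'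
      using i0 insert.prems by (subst sum.remove[of _ i0]) (auto simp: w_def)
    have "(\<Sum>i\<in>I. w i * f i e') = 0" if "e' \<in> J" for e'
    proof -
      have "(\<Sum>i\<in>I. w i * f i e') = (\<Sum>i\<in>?I. v i * (f i e' - f i e / f i0 e * f i0 e'))"
        unfolding split sum_divide_distrib sum_distrib_right sum_subtractf[symmetric]
        by (intro sum.cong refl) (simp add: algebra_simps)
      with v(2) that show ?thesis by simp
    qed
    moreover have "(\<Sum>i\<in>I. w i * f i e) = 0" using i0 by (simp add: split)
    moreover have "\<exists>i\<in>I. w i \<noteq> 0" using v(1) by (auto simp: w_def)
    ultimately show ?thesis by (intro exI[of _ w]) auto
  qed
qed

text \<open>Coprimality in Bezout form: it passes to products by multiplying two identities and is
  verified on linear factors by explicit cofactors.\<close>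

definition comaximal :: "'a :: comm_ring_1 \<Rightarrow> 'a \<Rightarrow> bool" where
  "comaximal p q \<longleftrightarrow> (\<exists>u v. u * p + v * q = 1)"

lemma comaximal_sym: "comaximal p q \<Longrightarrow> comaximal q p"
  unfolding comaximal_def by (metis add.commute)

lemma comaximal_mult:
  assumes "comaximal p q" "comaximal p r"
  shows "comaximal p (q * r)"
proof -
  obtain u v u' v' where "u * p + v * q = 1" "u' * p + v' * r = 1"
    using assms by (auto simp: comaximal_def)
  then have "1 = (u * p + v * q) * (u' * p + v' * r)" by simp
  also have "\<dots> = (u * u' * p + u * v' * r + v * q * u') * p + (v * v') * (q * r)"
    by (simp add: algebra_simps)
  finally show ?thesis unfolding comaximal_def by metis
qed

lemma comaximal_prod:
  assumes "\<And>i. i \<in> S \<Longrightarrow> comaximal p (f i)"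
  shows "comaximal p (prod f S)"
  using assms
proof (induction S rule: infinite_finite_induct)
  case (insert x F)
  then show ?case by (auto intro: comaximal_mult)
next
  case (infinite S)
  show ?case unfolding comaximal_def using infinite by (intro exI[of _ 0] exI[of _ 1]) simp
next
  case empty
  show ?case unfolding comaximal_def by (intro exI[of _ 0] exI[of _ 1]) simp
qed

lemma comaximal_dvd_mult: "comaximal p q \<Longrightarrow> q dvd r * p \<Longrightarrow> q dvd r"
proof -
  assume "comaximal p q" and d: "q dvd r * p"
  then obtain u v where "u * p + v * q = 1" by (auto simp: comaximal_def)
  then have "r = u * (r * p) + (r * v) * q" by (metis distrib_left mult.assoc mult.left_commute mult.right_neutral)
  with d show "q dvd r" by (metis dvd_add dvd_mult dvd_triv_right)
qed

lemma reflect_phi: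
  assumes "\<And>i. i \<in> {1..N} \<Longrightarrow> a i \<noteq> 0"
  shows "degree (phi N a) = N" and "reflect_poly (phi N a) = (\<Prod>i = 1..N. [:a i, 1:])"
proof -
  show "degree (phi N a) = N"
    unfolding phi_def using assms by (subst degree_prod_eq_sum_degree) auto
  have "reflect_poly (phi N a) = (\<Prod>i = 1..N. reflect_poly [:1, a i:])"
    unfolding phi_def by (rule reflect_poly_prod)
  also have "\<dots> = (\<Prod>i = 1..N. [:a i, 1:])"
    by (intro prod.cong refl) (use assms in \<open>auto simp: reflect_poly_def\<close>)
  finally show "reflect_poly (phi N a) = (\<Prod>i = 1..N. [:a i, 1:])" .
qed

text \<open>The roots \<open>-1 / a i\<close> lie outside the unit circle, the roots
  \<open>- a j\<close> of the reflection inside. Concretely, \<open>1 - a i * a j \<noteq> 0\<close>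
  supplies Bezout cofactors for each pair of linear factors.\<close>

lemma comaximal_phi_reflect:
  assumes "\<And>i. i \<in> {1..N} \<Longrightarrow> 0 < \<bar>a i\<bar> \<and> \<bar>a i\<bar> < 1"
  shows "comaximal (phi N a) (reflect_poly (phi N a))"
proof -
  have "comaximal [:1, a i:] [:a j, 1:]" if "i \<in> {1..N}" "j \<in> {1..N}" for i j
  proof -
    have "\<bar>a i * a j\<bar> < 1 * 1"
      unfolding abs_mult using assms that by (intro mult_strict_mono) auto
    then have ne: "1 - a i * a j \<noteq> 0" by auto
    have "[:1 / (1 - a i * a j):] * [:1, a i:] + [:- a i / (1 - a i * a j):] * [:a j, 1:] = 1"
      using ne by (simp add: one_pCons field_simps)
    then show ?thesis unfolding comaximal_def by blast
  qed
  then have "comaximal (phi N a) (\<Prod>i = 1..N. [:a i, 1:])"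
    unfolding phi_def by (intro comaximal_prod comaximal_sym[OF comaximal_prod]) (rule comaximal_sym)
  then show ?thesis using assms by (subst reflect_phi) force+
qed

text \<open>The number \<open>V e\<close> stands for \<open>s\<^sup>e\<close>: the equation for all \<open>V\<close> is an identity of Laurent polynomials in \<open>s\<close>.\<close>
lemma coefficient_system:
  fixes a :: "nat \<Rightarrow> real"
  assumes a: "\<And>i. i \<in> {1..N} \<Longrightarrow> 0 < \<bar>a i\<bar> \<and> \<bar>a i\<bar> < 1" and d: "d < N" and k: "k = N - d"
  obtains A B g :: "nat \<Rightarrow> real" where "\<exists>m\<le>d. g m \<noteq> 0"
    and "\<And>V :: int \<Rightarrow> real.
      (\<Sum>j<k. A j * (\<Sum>b\<le>N. coeff (phi N a) b * V (int b - int j))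
             + B j * (\<Sum>b\<le>N. coeff (phi N a) b * V (int d + 1 + int j - int b)))
      = (\<Sum>m\<le>d. g m * V (int m))"
proof -
  let ?c = "\<lambda>b. coeff (phi N a) b"
  \<comment> \<open>One vector of length \<open>2 * k\<close> holds the unknowns: positions below
    \<open>k\<close> are the \<open>A j\<close>, belonging to \<open>s^(-j) phi(s)\<close>, the
    others the \<open>B j\<close>, belonging to \<open>s^(d+1+j) phi(1/s)\<close>. Then
    \<open>\<epsilon> i b\<close> is the exponent met by coefficient \<open>b\<close>, and
    \<open>f i e\<close> is the coefficient of \<open>s^e\<close>.\<close>
  define \<epsilon> where "\<epsilon> i b = (if i < k then int b - int i else int d + 1 + int (i - k) - int b)" for i b
  define f where "f i e = (\<Sum>b\<le>N. if \<epsilon> i b = e then ?c b else 0)" for i e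
  \<comment> \<open>Since \<open>N = d + k\<close>, all exponents lie in \<open>?R\<close>, which
    has \<open>d + 2 * k\<close> elements; the \<open>d + 1\<close> exponents in \<open>?D\<close>
    may stay. This leaves \<open>2 * k - 1\<close> equations.\<close>
  let ?R = "{1 - int k..int N}" and ?D = "{0..int d}"
  have Dsub: "?D \<subseteq> ?R" using d k by auto
  have "card (?R - ?D) = card ?R - card ?D" using Dsub by (intro card_Diff_subset) auto
  then have "card (?R - ?D) < card {..<2*k}" using d k by simp
  then obtain v where v: "\<exists>i<2*k. v i \<noteq> 0" "\<And>e. e \<in> ?R - ?D \<Longrightarrow> (\<Sum>i<2*k. v i * f i e) = 0"
  proof -
    have "\<exists>v. (\<exists>i\<in>{..<2*k}. v i \<noteq> 0) \<and> (\<forall>e\<in>?R - ?D. (\<Sum>i\<in>{..<2*k}. v i * f i e) = 0)"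
      using \<open>card (?R - ?D) < card {..<2*k}\<close> by (intro homogeneous_system_nontrivial) auto
    then show ?thesis using that unfolding Bex_def lessThan_iff by blast
  qed
  define A where "A j = v j" for j
  define B where "B j = v (k + j)" for j
  define g where "g m = (\<Sum>i<2*k. v i * f i (int m))" for m
  have f_sum: "(\<Sum>e\<in>?R. f i e * V e) = (\<Sum>b\<le>N. ?c b * V (\<epsilon> i b))" if "i < 2 * k" for i V
  proof -
    have "(\<Sum>e\<in>?R. f i e * V e) = (\<Sum>b\<le>N. \<Sum>e\<in>?R. if \<epsilon> i b = e then ?c b * V e else 0)"
      unfolding f_def sum_distrib_right by (subst sum.swap) (intro sum.cong refl, auto)
    also have "\<dots> = (\<Sum>b\<le>N. ?c b * V (\<epsilon> i b))"
      using that d k by (intro sum.cong refl) (auto simp: \<epsilon>_def)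
    finally show ?thesis .
  qed
  have two_k: "sum h {..<2*k} = (\<Sum>j<k. h j + h (k + j))" for h :: "nat \<Rightarrow> real"
  proof -
    have "sum h {..<2*k} = sum h {0..<k} + sum h {0 + k..<k + k}"
      by (simp add: sum.atLeastLessThan_concat lessThan_atLeast0 mult_2)
    also have "sum h {0 + k..<k + k} = (\<Sum>j<k. h (k + j))"
      unfolding sum.shift_bounds_nat_ivl by (simp add: lessThan_atLeast0 add.commute)
    finally show ?thesis by (simp add: sum.distrib lessThan_atLeast0)
  qed
  have main: "(\<Sum>j<k. A j * (\<Sum>b\<le>N. ?c b * V (int b - int j))
             + B j * (\<Sum>b\<le>N. ?c b * V (int d + 1 + int j - int b)))
      = (\<Sum>m\<le>d. g m * V (int m))" for V
  proof -
    have "(\<Sum>j<k. A j * (\<Sum>b\<le>N. ?c b * V (int b - int j))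
             + B j * (\<Sum>b\<le>N. ?c b * V (int d + 1 + int j - int b)))
       = (\<Sum>i<2*k. v i * (\<Sum>b\<le>N. ?c b * V (\<epsilon> i b)))"
      unfolding two_k by (simp add: A_def B_def \<epsilon>_def)
    also have "\<dots> = (\<Sum>i<2*k. v i * (\<Sum>e\<in>?R. f i e * V e))"
      by (intro sum.cong refl) (simp add: f_sum)
    also have "\<dots> = (\<Sum>e\<in>?R. (\<Sum>i<2*k. v i * f i e) * V e)"
      unfolding sum_distrib_left sum_distrib_right by (subst sum.swap) (simp add: mult_ac)
    also have "\<dots> = (\<Sum>e\<in>?D. (\<Sum>i<2*k. v i * f i e) * V e)"
      using Dsub v(2) by (intro sum.mono_neutral_right) auto
    also have "\<dots> = (\<Sum>m\<le>d. g m * V (int m))"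
      unfolding g_def
      by (rule sum.reindex_bij_witness[of _ int nat]) auto
    finally show ?thesis .
  qed
  \<comment> \<open>If all \<open>g m\<close> vanish, coprimality makes the reciprocal of \<open>\<phi>\<close> divide \<open>P\<close>, whose degree is too small.\<close>
  have "\<exists>m\<le>d. g m \<noteq> 0"
  proof (rule ccontr)
    assume "\<not> (\<exists>m\<le>d. g m \<noteq> 0)"
    then have g0: "\<And>m. m \<le> d \<Longrightarrow> g m = 0" by auto
    \<comment> \<open>Multiplication by \<open>s^(k-1)\<close> clears negative exponents:
      \<open>s^(-j)\<close> becomes \<open>s^(k-1-j)\<close> and \<open>s^(d+1+j)\<close> becomes
      \<open>s^j * s^N\<close>. Hence the reversed order in \<open>P\<close> only.\<close>
    define P where "P = (\<Sum>j<k. monom (A j) (k - 1 - j))"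
    define Q where "Q = (\<Sum>j<k. monom (B j) j)"
    let ?p = "phi N a" and ?q = "reflect_poly (phi N a)"
    have nz: "\<And>i. i \<in> {1..N} \<Longrightarrow> a i \<noteq> 0" using a by force
    have deg: "degree ?p = N" using reflect_phi(1)[of N a] nz by blast
    have degq: "degree ?q = N" by (simp add: deg coeff_phi_0)
    have pq: "poly ?q s = (\<Sum>b\<le>N. ?c b * s ^ (N - b))" for s
    proof -
      have "poly ?q s = (\<Sum>i\<le>N. coeff ?q i * s ^ i)" using degq by (intro poly_sum_le) auto
      also have "\<dots> = (\<Sum>i\<le>N. ?c (N - i) * s ^ i)"
        by (intro sum.cong refl) (auto simp: coeff_reflect_poly deg)
      also have "\<dots> = (\<Sum>b\<le>N. ?c b * s ^ (N - b))"
        by (rule sum.reindex_bij_witness[of _ "\<lambda>b. N - b" "\<lambda>b. N - b"]) auto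
      finally show ?thesis .
    qed
    have "poly (P * ?p + Q * ?q) s = 0" for s
    proof -
      \<comment> \<open>Here \<open>V e\<close> is \<open>s^(e+k-1)\<close>; \<open>nat\<close>
        truncates nothing, because every exponent is at least \<open>1 - k\<close>.\<close>
      have "0 = (\<Sum>j<k. A j * (\<Sum>b\<le>N. ?c b * s ^ nat (int b - int j + int k - 1))
             + B j * (\<Sum>b\<le>N. ?c b * s ^ nat (int d + 1 + int j - int b + int k - 1)))"
        using main[of "\<lambda>e. s ^ nat (e + int k - 1)"] g0 by simp
      also have "\<dots> = (\<Sum>j<k. A j * (s ^ (k - 1 - j) * (\<Sum>b\<le>N. ?c b * s ^ b)) + B j * (s ^ j * (\<Sum>b\<le>N. ?c b * s ^ (N - b))))"
      proof (intro sum.cong refl arg_cong2[where f = "(+)"] arg_cong2[where f = "(*)"])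
        fix j assume j: "j \<in> {..<k}"
        have "nat (int b - int j + int k - 1) = (k - 1 - j) + b" for b using j by auto
        then show "(\<Sum>b\<le>N. ?c b * s ^ nat (int b - int j + int k - 1)) = s ^ (k - 1 - j) * (\<Sum>b\<le>N. ?c b * s ^ b)"
          by (simp add: sum_distrib_left power_add mult_ac)
        have "s ^ nat (int d + 1 + int j - int b + int k - 1) = s ^ j * s ^ (N - b)" if "b \<in> {..N}" for b
        proof -
          have "nat (int d + 1 + int j - int b + int k - 1) = j + (N - b)" using j d k that by auto
          then show ?thesis by (simp only: power_add)
        qed
        then show "(\<Sum>b\<le>N. ?c b * s ^ nat (int d + 1 + int j - int b + int k - 1)) = s ^ j * (\<Sum>b\<le>N. ?c b * s ^ (N - b))"
          unfolding sum_distrib_left by (intro sum.cong refl) (simp only: mult_ac)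
      qed
      also have "\<dots> = poly (P * ?p + Q * ?q) s"
        using degree_phi[of N a]
        by (simp add: pq P_def Q_def poly_sum poly_monom poly_sum_le[of ?p N] sum_distrib_right sum.distrib mult_ac)
      finally show ?thesis by simp
    qed
    then have PQ: "P * ?p + Q * ?q = 0" using poly_all_0_iff_0 by blast
    then have "P * ?p = ?q * (- Q)" by (simp add: algebra_simps eq_neg_iff_add_eq_0)
    then have "?q dvd P * ?p" by (metis dvd_triv_left)
    moreover have "comaximal ?p ?q" by (rule comaximal_phi_reflect) (rule a)
    ultimately have dv: "?q dvd P" by (rule comaximal_dvd_mult[rotated])
    have "degree P \<le> k - 1" unfolding P_def
      by (intro degree_sum_le) (auto intro: order_trans[OF degree_monom_le])
    then have "degree P < degree ?q" using degq d k by simp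
    then have P0: "P = 0" using dvd_imp_degree_le[OF dv] by (meson not_less)
    moreover have "?q \<noteq> 0" using degq d by auto
    ultimately have Q0: "Q = 0" using PQ by simp
    have "v i = 0" if "i < 2 * k" for i
    proof (cases "i < k")
      case True
      have "coeff P (k - 1 - i) = (\<Sum>j<k. if j = i then A j else 0)"
        unfolding P_def coeff_sum using True by (intro sum.cong refl) auto
      with True P0 show ?thesis by (simp add: A_def)
    next
      case False
      have "coeff Q (i - k) = B (i - k)"
        unfolding Q_def coeff_sum using False that by (simp add: sum.delta)
      with False Q0 show ?thesis by (simp add: B_def)
    qed
    with v(1) show False by blast
  qed
  with main show ?thesis by (intro that)
qed

section \<open>Integrals over the interval\<close>

lemma unit_semicircle_norm: "x \<in> {-1..1} \<Longrightarrow> cmod (Complex x (sqrt (1 - x\<^sup>2))) = 1"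
  by (auto simp: cmod_def abs_square_le_1 real_sqrt_pow2 abs_le_iff)

text \<open>Cauchy's formula at the centre: along \<open>circlepath\<close> the derivative divided
  by the point is the constant \<open>2 * pi * \<i>\<close>, which cancels.\<close>

lemma mean_value_circle:
  assumes "continuous_on (cball 0 1) f" "f holomorphic_on ball 0 1"
  shows "((\<lambda>t. f (cis (2 * pi * t))) has_integral f 0) {0..1}"
proof -
  have "((\<lambda>u. f u / (u - 0)) has_contour_integral (2 * of_real pi * \<i> * f 0)) (circlepath 0 1)"
    using assms by (intro Cauchy_integral_circlepath) auto
  then have "((\<lambda>t. f (circlepath 0 1 t) / circlepath 0 1 t * vector_derivative (circlepath 0 1) (at t within {0..1}))
      has_integral (2 * of_real pi * \<i> * f 0)) {0..1}"
    by (simp add: has_contour_integral_def)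
  then have "((\<lambda>t. 2 * of_real pi * \<i> * f (cis (2 * pi * t))) has_integral (2 * of_real pi * \<i> * f 0)) {0..1}"
  proof (rule has_integral_eq[rotated])
    fix t :: real assume t: "t \<in> {0..1}"
    have "circlepath 0 1 t = cis (2 * pi * t)"
      by (simp add: circlepath cis_conv_exp mult_ac)
    moreover have "vector_derivative (circlepath 0 1) (at t within {0..1}) = 2 * of_real pi * \<i> * cis (2 * pi * t)"
      using t vector_derivative_circlepath01[of t 0 1] by (simp add: cis_conv_exp mult_ac)
    ultimately show "f (circlepath 0 1 t) / circlepath 0 1 t * vector_derivative (circlepath 0 1) (at t within {0..1})
        = 2 * of_real pi * \<i> * f (cis (2 * pi * t))" by simp
  qed
  from has_integral_mult_right[OF this, of "inverse (2 * of_real pi * \<i>)"]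
  show ?thesis by (simp add: field_simps)
qed

text \<open>This reduces the full circle to its upper half, the part that
  \<open>x = cos \<theta>\<close> covers once.\<close>

lemma has_integral_half_symmetric:
  fixes J :: "real \<Rightarrow> real"
  assumes cont: "continuous_on {0..1} J" and sym: "\<And>t. J (1 - t) = J t"
    and int: "(J has_integral I) {0..1}"
  shows "(J has_integral I / 2) {0..1/2}"
proof -
  have c1: "continuous_on {0..1/2} J" and c2: "continuous_on {1/2..1} J"
    by (rule continuous_on_subset[OF cont]; auto)+
  have "((\<lambda>t. (-1) *\<^sub>R J (1 - t)) has_integral (integral {1 - 1/2..1 - 1} J - integral {1 - 1..1 - 1/2} J)) {1/2..1}"
    by (rule has_integral_substitution_general[of "{}" "1/2" 1 "\<lambda>t. 1 - t" 0 "1/2"])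
       (auto intro!: c1 continuous_intros derivative_eq_intros)
  then have "((\<lambda>t. - J t) has_integral - integral {0..1/2} J) {1/2..1}" by (simp add: sym)
  then have "integral {1/2..1} J = integral {0..1/2} J"
    by (subst (asm) has_integral_neg_iff) (simp add: integral_unique)
  moreover have "integral {0..1/2} J + integral {1/2..1} J = integral {0..1} J"
    using cont by (intro Henstock_Kurzweil_Integration.integral_combine) (auto intro: integrable_continuous_real)
  moreover have "integral {0..1} J = I" using int by (rule integral_unique)
  ultimately have "integral {0..1/2} J = I / 2" by simp
  then show ?thesis using integrable_continuous_real[OF c1] by (metis integrable_integral)
qed

text \<open>Put \<open>x = cos \<theta>\<close> and \<open>z = cis \<theta>\<close>. The sine times
  the Chebyshev combination is \<open>Im (z^(r+1) * cnj (H z))\<close>, so dividing by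
  \<open>|H z|^2\<close> leaves \<open>Im (z^(r+1) / H z)\<close>. Up to a factor, the moment
  becomes the mean over the circle of the real part of a function holomorphic in the disc; its value
  at \<open>0\<close> vanishes for \<open>k < r\<close> and is fixed by \<open>H 0 = 1\<close> for
  \<open>k = r\<close>.\<close>

lemma cheb_combination_integral:
  fixes f :: "nat \<Rightarrow> real" and M r k :: nat
  defines "H \<equiv> \<lambda>z. \<Sum>i\<le>M. of_real (f i) * z ^ i"
  assumes f0: "f 0 = 1" and nz: "\<And>z. cmod z \<le> 1 \<Longrightarrow> H z \<noteq> 0" and k: "k \<le> r"
  shows "((\<lambda>x. (\<Sum>i\<le>M. f i * cheb_U (int r - int i) x) * x ^ k * sqrt (1 - x\<^sup>2)
            / (cmod (H (Complex x (sqrt (1 - x\<^sup>2)))))\<^sup>2)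
          has_integral (if k = r then pi / 2 ^ (r + 1) else 0)) {-1..1}"
proof -
  define F where "F x = (\<Sum>i\<le>M. f i * cheb_U (int r - int i) x) * x ^ k * sqrt (1 - x\<^sup>2)
            / (cmod (H (Complex x (sqrt (1 - x\<^sup>2)))))\<^sup>2" for x
  \<comment> \<open>On the unit circle \<open>G(z) = 2\<^sup>k\<^sup>+\<^sup>1 \<i> sin \<theta> cos\<^sup>k \<theta> z\<^sup>r\<^sup>+\<^sup>1 / H(z)\<close>, so the mean value \<open>G 0\<close> gives the integral of \<open>J\<close>.\<close>
  define G where "G z = z ^ (r - k) * ((z\<^sup>2 + 1) ^ k * (z\<^sup>2 - 1)) / H z" for z
  define J where "J t = sin (2 * pi * t) * cos (2 * pi * t) ^ k * Im (cis (2 * pi * t) ^ (r + 1) / H (cis (2 * pi * t)))" for t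
  have Re_of_real_mult: "Re (of_real c * z) = c * Re z" and Im_of_real_mult: "Im (of_real c * z) = c * Im z" for c z
    by simp_all
  obtain u where u: "\<And>k x. cheb_U k x = poly (u k) x" using cheb_U_poly_ex by metis
  have Hcnj: "H (cnj z) = cnj (H z)" for z by (simp add: H_def)
  have Hhol: "H holomorphic_on S" for S unfolding H_def by (intro holomorphic_intros)
  have Hcont: "continuous_on S H" for S using Hhol by (rule holomorphic_on_imp_continuous_on)
  have "((\<lambda>t. G (cis (2 * pi * t))) has_integral G 0) {0..1}"
  proof (rule mean_value_circle)
    show "G holomorphic_on ball 0 1" unfolding G_def
      by (intro holomorphic_intros Hhol) (use nz in auto)
    show "continuous_on (cball 0 1) G" unfolding G_def
      by (intro continuous_intros Hcont) (use nz in auto)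
  qed
  then have "((\<lambda>t. Re (G (cis (2 * pi * t)))) has_integral Re (G 0)) {0..1}"
    by (rule has_integral_Re)
  then have "((\<lambda>t. - Re (G (cis (2 * pi * t))) / 2 ^ (k + 1)) has_integral (- Re (G 0) / 2 ^ (k + 1))) {0..1}"
    by (intro has_integral_divide has_integral_neg)
  moreover have "- Re (G (cis (2 * pi * t))) / 2 ^ (k + 1) = J t" for t
  proof -
    let ?\<theta> = "2 * pi * t"
    let ?e = "cis ?\<theta>"
    have e1: "?e\<^sup>2 + 1 = 2 * of_real (cos ?\<theta>) * ?e" and e2: "?e\<^sup>2 - 1 = 2 * \<i> * of_real (sin ?\<theta>) * ?e"
      using sin_cos_squared_add3[of ?\<theta>]
      by (auto simp: complex_eq_iff power2_eq_square algebra_simps)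
    have "?e ^ (r - k) * ?e ^ k = ?e ^ r" using k by (simp flip: power_add)
    then have "G ?e = of_real (2 ^ (k + 1) * (sin ?\<theta> * cos ?\<theta> ^ k)) * (\<i> * (?e ^ (r + 1) / H ?e))"
      unfolding G_def e1 e2 by (simp add: power_mult_distrib field_simps)
    then have "Re (G ?e) = - (2 ^ (k + 1) * (sin ?\<theta> * cos ?\<theta> ^ k)) * Im (?e ^ (r + 1) / H ?e)"
      by (simp only: Re_of_real_mult Re_i_times mult_minus_right mult_minus_left)
    then show ?thesis by (simp add: J_def)
  qed
  moreover have "- Re (G 0) / 2 ^ (k + 1) = (if k = r then 1 / 2 ^ (r + 1) else 0)"
  proof -
    have "H 0 = (\<Sum>i\<le>M. if i = 0 then 1 else 0)"
      unfolding H_def by (intro sum.cong refl) (auto simp: f0)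
    then have "H 0 = 1" by simp
    then show ?thesis using k by (simp add: G_def zero_power)
  qed
  ultimately have J1: "(J has_integral (if k = r then 1 / 2 ^ (r + 1) else 0)) {0..1}" by simp
  have Jc: "continuous_on S J" for S
    unfolding J_def
    by (intro continuous_intros continuous_on_compose2[OF Hcont[of UNIV]]) (use nz in auto)
  \<comment> \<open>Passing to \<open>1 - t\<close> conjugates the point on the circle. As
    \<open>H\<close> has real coefficients, the sine and the imaginary part both change
    sign.\<close>
  have "J (1 - t) = J t" for t
  proof -
    have "sin (2 * pi * (1 - t)) = - sin (2 * pi * t)" "cos (2 * pi * (1 - t)) = cos (2 * pi * t)"
      by (simp_all add: right_diff_distrib sin_diff cos_diff)
    moreover from this have "cis (2 * pi * (1 - t)) = cnj (cis (2 * pi * t))"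
      by (simp add: complex_eq_iff)
    moreover have "cnj e ^ (r + 1) / H (cnj e) = cnj (e ^ (r + 1) / H e)" for e
      by (simp add: Hcnj)
    ultimately show ?thesis
      unfolding J_def by (simp only: cnj.sel)
  qed
  from has_integral_half_symmetric[OF Jc this J1]
  have J2: "(J has_integral (if k = r then 1 / 2 ^ (r + 1) else 0) / 2) {0..1/2}" .
  have Fc: "continuous_on {-1..1} F"
  proof -
    have "continuous_on {-1..1} (\<lambda>x. H (Complex x (sqrt (1 - x\<^sup>2))))"
      by (rule continuous_on_compose2[OF Hcont[of UNIV]])
         (auto simp: Complex_eq intro!: continuous_intros)
    then show ?thesis unfolding F_def u
      by (intro continuous_intros) (use nz unit_semicircle_norm in auto)
  qed
  \<comment> \<open>The cosine runs from \<open>1\<close> down to \<open>-1\<close>, so the first of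
    the two integrals is over an empty interval and the second brings a minus sign.\<close>
  have "((\<lambda>t. (- 2 * pi * sin (2 * pi * t)) *\<^sub>R F (cos (2 * pi * t))) has_integral
      (integral {cos (2 * pi * 0)..cos (2 * pi * (1/2))} F - integral {cos (2 * pi * (1/2))..cos (2 * pi * 0)} F)) {0..1/2}"
    by (rule has_integral_substitution_general[of "{}" 0 "1/2" "\<lambda>t. cos (2 * pi * t)" "-1" 1])
       (auto intro!: Fc continuous_intros derivative_eq_intros)
  then have "((\<lambda>t. (- 2 * pi * sin (2 * pi * t)) * F (cos (2 * pi * t))) has_integral (- integral {-1..1} F)) {0..1/2}"
    by simp
  \<comment> \<open>Two sines occur, from the differential and from the weight: one turns the
    Chebyshev combination into an imaginary part, the other remains in \<open>J\<close>.\<close>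
  moreover have "(- 2 * pi * sin (2 * pi * t)) * F (cos (2 * pi * t)) = (- 2 * pi) * J t" if t: "t \<in> {0..1/2}" for t
  proof -
    let ?\<theta> = "2 * pi * t"
    let ?e = "cis ?\<theta>"
    have s0: "sin ?\<theta> \<ge> 0" using t by (intro sin_ge_zero) auto
    have sq: "sqrt (1 - (cos ?\<theta>)\<^sup>2) = sin ?\<theta>"
      using s0 by (simp add: sin_squared_eq[symmetric])
    then have ce: "Complex (cos ?\<theta>) (sqrt (1 - (cos ?\<theta>)\<^sup>2)) = ?e" by (simp add: cis.ctr)
    have "sin ?\<theta> * (\<Sum>i\<le>M. f i * cheb_U (int r - int i) (cos ?\<theta>)) = (\<Sum>i\<le>M. f i * sin (of_int (int r - int i + 1) * ?\<theta>))"
      unfolding sum_distrib_left sin_cheb_U[symmetric] by (simp add: mult_ac)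
    also have "\<dots> = (\<Sum>i\<le>M. Im (?e ^ (r + 1) * (of_real (f i) * cnj ?e ^ i)))"
    proof (intro sum.cong refl)
      fix i
      have "?e ^ (r + 1) * cnj ?e ^ i = cis (of_int (int r - int i + 1) * ?\<theta>)"
        unfolding cis_cnj Complex.DeMoivre cis_mult by (simp add: algebra_simps)
      then have "?e ^ (r + 1) * (of_real (f i) * cnj ?e ^ i) = of_real (f i) * cis (of_int (int r - int i + 1) * ?\<theta>)"
        by (simp only: mult.left_commute)
      then show "f i * sin (of_int (int r - int i + 1) * ?\<theta>) = Im (?e ^ (r + 1) * (of_real (f i) * cnj ?e ^ i))"
        by (simp only: Im_of_real_mult cis.simps)
    qed
    also have "\<dots> = Im (?e ^ (r + 1) * cnj (H ?e))"
      by (simp only: Im_sum[symmetric] sum_distrib_left[symmetric]) (simp add: H_def)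
    also have "?e ^ (r + 1) * cnj (H ?e) = of_real ((cmod (H ?e))\<^sup>2) * (?e ^ (r + 1) / H ?e)"
      using nz[of ?e] unfolding complex_norm_square by simp
    finally have "sin ?\<theta> * (\<Sum>i\<le>M. f i * cheb_U (int r - int i) (cos ?\<theta>)) =
        (cmod (H ?e))\<^sup>2 * Im (?e ^ (r + 1) / H ?e)"
      by (simp only: Im_of_real_mult)
    then show ?thesis
      using nz[of ?e] unfolding F_def J_def ce unfolding sq by (simp add: field_simps)
  qed
  ultimately have "((\<lambda>t. (- 2 * pi) * J t) has_integral (- integral {-1..1} F)) {0..1/2}"
    by (rule has_integral_eq[rotated]) auto
  moreover have "((\<lambda>t. (- 2 * pi) * J t) has_integral ((- 2 * pi) * ((if k = r then 1 / 2 ^ (r + 1) else 0) / 2))) {0..1/2}"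
    using J2 by (rule has_integral_mult_right)
  ultimately have "- integral {-1..1} F = (- 2 * pi) * ((if k = r then 1 / 2 ^ (r + 1) else 0) / 2)"
    by (rule has_integral_unique)
  then have "integral {-1..1} F = (if k = r then pi / 2 ^ (r + 1) else 0)" by (simp split: if_splits)
  moreover have "F integrable_on {-1..1}" using Fc by (rule integrable_continuous_real)
  ultimately have "(F has_integral (if k = r then pi / 2 ^ (r + 1) else 0)) {-1..1}"
    by (metis integrable_integral)
  then show ?thesis by (simp add: F_def[abs_def])
qed

section \<open>The weight on the square\<close>

abbreviation square :: "(real \<times> real) set" where
  "square \<equiv> {-1..1} \<times> {-1..1}"

abbreviation cont2 :: "(real \<Rightarrow> real \<Rightarrow> real) \<Rightarrow> bool" where
  "cont2 f \<equiv> continuous_on UNIV (\<lambda>v. f (fst v) (snd v))"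

lemma omega_nonzero:
  assumes "\<And>i. i \<in> {1..N} \<Longrightarrow> \<bar>a i\<bar> < 1" "cmod z \<le> 1" "cmod w \<le> 1"
  shows "omega N a z w \<noteq> 0"
proof -
  have "1 + complex_of_real (a i) * z * w \<noteq> 0" if "i \<in> {1..N}" for i
  proof
    assume "1 + complex_of_real (a i) * z * w = 0"
    then have "cmod (complex_of_real (a i) * z * w) = cmod (-1)"
      by (metis add_eq_0_iff)
    then have "\<bar>a i\<bar> * (cmod z * cmod w) = 1" by (simp add: norm_mult)
    moreover have "\<bar>a i\<bar> * (cmod z * cmod w) \<le> \<bar>a i\<bar> * 1"
      using assms by (intro mult_left_mono mult_le_one) auto
    ultimately show False using assms(1)[OF that] by simp
  qed
  then show ?thesis by (simp add: omega_def)
qed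

text \<open>As \<open>omega\<close> is symmetric, exchanging the variables trades the two
  expressions for the weight in \<open>weight_unit_circle\<close>.\<close>

lemma weight_swap:
  assumes "x \<in> {-1..1}" "y \<in> {-1..1}"
  shows "weight N a y x = weight N a x y"
proof -
  define z where "z = Complex x (sqrt (1 - x\<^sup>2))"
  define w where "w = Complex y (sqrt (1 - y\<^sup>2))"
  have "cmod z = 1" "cmod w = 1" "Re z = x" "Re w = y"
    using assms unit_semicircle_norm by (auto simp: z_def w_def)
  then show ?thesis
    using weight_unit_circle(1)[of z w N a] weight_unit_circle(2)[of w z N a]
    by (simp add: omega_commute[of N a w z] omega_commute[of N a "1 / w" z] mult.commute)
qed

lemma weight_denom_pos:
  assumes a: "\<And>i. i \<in> {1..N} \<Longrightarrow> \<bar>a i\<bar> < 1" and "cmod z = 1" "cmod w = 1"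
  shows "0 < (cmod (omega N a z w * omega N a z (1 / w)))\<^sup>2"
  using omega_nonzero[of N a z w] omega_nonzero[of N a z "1 / w"] assms by (simp add: norm_divide)

lemma weight_nonneg: "x \<in> {-1..1} \<Longrightarrow> y \<in> {-1..1} \<Longrightarrow> 0 \<le> weight N a x y"
  by (auto simp: weight_def Let_def abs_square_le_1 abs_le_iff)

lemma weight_pos:
  assumes a: "\<And>i. i \<in> {1..N} \<Longrightarrow> \<bar>a i\<bar> < 1" and "x \<in> {-1<..<1}" "y \<in> {-1<..<1}"
  shows "0 < weight N a x y"
proof -
  have "0 < 1 - x\<^sup>2" "0 < 1 - y\<^sup>2" using assms by (auto simp: abs_square_less_1)
  then show ?thesis
    using weight_denom_pos[OF a unit_semicircle_norm[of x] unit_semicircle_norm[of y]] assms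
    unfolding weight_def Let_def by (intro divide_pos_pos mult_pos_pos) auto
qed

lemma weight_continuous:
  assumes a: "\<And>i. i \<in> {1..N} \<Longrightarrow> \<bar>a i\<bar> < 1"
  shows "continuous_on square (\<lambda>v. weight N a (fst v) (snd v))"
proof -
  have om: "continuous_on S (\<lambda>v. omega N a (f v) (g v))"
    if "continuous_on S f" "continuous_on S g" for f g and S :: "(real \<times> real) set"
    unfolding omega_def using that by (intro continuous_intros)
  have "Complex (snd v) (sqrt (1 - (snd v)\<^sup>2)) \<noteq> 0" if "v \<in> square" for v :: "real \<times> real"
    using unit_semicircle_norm[of "snd v"] that by (auto simp del: unit_semicircle_norm)
  then show ?thesis
    unfolding weight_def Let_def Complex_eq
    apply (intro continuous_intros om)
    using weight_denom_pos[OF a unit_semicircle_norm unit_semicircle_norm]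
    by (fastforce simp: Complex_eq)+
qed

lemma set_integrable_weight:
  assumes a: "\<And>i. i \<in> {1..N} \<Longrightarrow> \<bar>a i\<bar> < 1" and f: "cont2 f"
  shows "set_integrable lborel square (\<lambda>v. f (fst v) (snd v) * weight N a (fst v) (snd v))"
  unfolding set_integrable_def
  by (intro borel_integrable_compact continuous_on_mult continuous_on_subset[OF f] weight_continuous[OF a])
     (auto intro: compact_Times)

lemma weight_integral_alt:
  "weight_integral N a f = (LINT v:square|lborel. f (fst v) (snd v) * weight N a (fst v) (snd v))"
  by (simp add: weight_integral_def case_prod_unfold)

lemma weight_integral_sum:
  assumes a: "\<And>i. i \<in> {1..N} \<Longrightarrow> \<bar>a i\<bar> < 1" and f: "\<And>s. s \<in> S \<Longrightarrow> cont2 (f s)"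
  shows "weight_integral N a (\<lambda>x y. \<Sum>s\<in>S. f s x y) = (\<Sum>s\<in>S. weight_integral N a (f s))"
  unfolding weight_integral_alt set_lebesgue_integral_def sum_distrib_right scaleR_sum_right
  using set_integrable_weight[OF a f]
  by (subst Bochner_Integration.integral_sum) (simp_all add: set_integrable_def)

lemma weight_integral_add:
  assumes a: "\<And>i. i \<in> {1..N} \<Longrightarrow> \<bar>a i\<bar> < 1" and "cont2 f" "cont2 g"
  shows "weight_integral N a (\<lambda>x y. f x y + g x y) = weight_integral N a f + weight_integral N a g"
  using set_integrable_weight[OF a assms(2)] set_integrable_weight[OF a assms(3)]
  unfolding weight_integral_alt by (simp add: distrib_right)

lemma weight_integral_cmult:
  "weight_integral N a (\<lambda>x y. c * f x y) = c * weight_integral N a f"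
  unfolding weight_integral_alt by (simp add: mult.assoc)

lemma weight_integral_iterated:
  assumes a: "\<And>i. i \<in> {1..N} \<Longrightarrow> \<bar>a i\<bar> < 1" and f: "cont2 f"
  shows "weight_integral N a f = (LINT y:{-1..1}|lborel. LINT x:{-1..1}|lborel. f x y * weight N a x y)"
    and "weight_integral N a f = (LINT x:{-1..1}|lborel. LINT y:{-1..1}|lborel. f x y * weight N a x y)"
proof -
  let ?F = "\<lambda>x y. indicator square (x, y) *\<^sub>R (f x y * weight N a x y)"
  have int: "integrable (lborel \<Otimes>\<^sub>M lborel) (case_prod ?F)"
    using set_integrable_weight[OF a f] by (simp add: lborel_prod set_integrable_def case_prod_unfold)
  have W: "weight_integral N a f = integral\<^sup>L (lborel \<Otimes>\<^sub>M lborel) (case_prod ?F)"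
    by (simp add: lborel_prod weight_integral_alt set_lebesgue_integral_def case_prod_unfold)
  have ind: "indicator square (x, y) = (indicator {-1..1} x * indicator {-1..1} y :: real)" for x y :: real
    by (simp add: indicator_def)
  show "weight_integral N a f = (LINT y:{-1..1}|lborel. LINT x:{-1..1}|lborel. f x y * weight N a x y)"
    unfolding W lborel_pair.integral_snd[OF int, symmetric]
    by (simp add: ind set_lebesgue_integral_def mult_ac flip: integral_mult_right_zero)
  show "weight_integral N a f = (LINT x:{-1..1}|lborel. LINT y:{-1..1}|lborel. f x y * weight N a x y)"
    unfolding W lborel_pair.integral_fst[OF int, symmetric]
    by (simp add: ind set_lebesgue_integral_def mult_ac flip: integral_mult_right_zero)
qed

lemma weight_integral_swap:
  assumes a: "\<And>i. i \<in> {1..N} \<Longrightarrow> \<bar>a i\<bar> < 1" and f: "cont2 f"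
  shows "weight_integral N a (\<lambda>x y. f y x) = weight_integral N a f"
proof -
  have f': "cont2 (\<lambda>x y. f y x)"
  proof -
    have "continuous_on UNIV (\<lambda>v :: real \<times> real. (snd v, fst v))" by (intro continuous_intros)
    from continuous_on_compose2[OF f this] show ?thesis by simp
  qed
  have "weight_integral N a (\<lambda>x y. f y x) = (LINT x:{-1..1}|lborel. LINT y:{-1..1}|lborel. f y x * weight N a y x)"
    by (subst weight_integral_iterated(2)[where f = "\<lambda>x y. f y x", OF a f'], assumption)
       (auto simp: weight_swap intro!: set_lebesgue_integral_cong)
  also have "\<dots> = weight_integral N a f" by (rule weight_integral_iterated(1)[OF a f, symmetric])
  finally show ?thesis .
qed

lemma cont2_poly_x: "cont2 (\<lambda>x y. poly p x)" and cont2_poly_y: "cont2 (\<lambda>x y. poly p y)"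
  by (intro continuous_intros)+

lemma cont2_cheb_U_x: "cont2 (\<lambda>x y. cheb_U k x)" and cont2_cheb_U_y: "cont2 (\<lambda>x y. cheb_U k y)"
proof -
  obtain u where "\<And>x. cheb_U k x = poly u x" using cheb_U_poly_ex by metis
  then show "cont2 (\<lambda>x y. cheb_U k x)" "cont2 (\<lambda>x y. cheb_U k y)"
    by (simp_all add: cont2_poly_x cont2_poly_y)
qed

lemma cont2_q_poly: "cont2 (q_poly N a r)"
  unfolding q_poly_def by (intro continuous_intros cont2_cheb_U_x)

lemma cont2_qt_poly: "cont2 (qt_poly N a r)"
  unfolding qt_poly_def by (intro continuous_intros cont2_cheb_U_y)

lemma eval2_pCons: "eval2 (pCons c p) x y = poly c x + y * eval2 p x y"
  by (simp add: eval2_def)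

lemma eval2_0: "eval2 0 x y = 0" by (simp add: eval2_def)

lemma cont2_eval2: "cont2 (eval2 p)"
proof (induction p)
  case 0
  then show ?case by (simp add: eval2_0)
next
  case (pCons c p)
  then show ?case unfolding eval2_pCons by (intro continuous_intros)
qed

section \<open>Orthogonality of \<open>q_poly\<close> and \<open>qt_poly\<close>\<close>

lemma cheb_U_moment:
  assumes "k \<le> l"
  shows "((\<lambda>y. cheb_U (int l) y * y ^ k * sqrt (1 - y\<^sup>2)) has_integral (if k = l then pi / 2 ^ (l + 1) else 0)) {-1..1}"
  using cheb_combination_integral[of "\<lambda>_. 1" 0 k l] assms by simp

text \<open>For fixed \<open>y\<close> the inner integral over \<open>x\<close> is an instance of
  \<open>cheb_combination_integral\<close>: \<open>h(z,y)\<close> has no zero in the closed disc,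
  since \<open>|w| = 1\<close>, and \<open>h_0(y) = 1\<close>. This uses up the denominator of the
  weight, so the outer integral contains only the Chebyshev weight.\<close>

lemma weight_integral_q_poly:
  assumes a: "\<And>i. i \<in> {1..N} \<Longrightarrow> \<bar>a i\<bar> < 1" and k: "k \<le> r" and g: "continuous_on UNIV g"
  shows "weight_integral N a (\<lambda>x y. q_poly N a (int r) x y * x ^ k * g y) =
    (if k = r then 2 / (pi * 2 ^ r) * integral {-1..1} (\<lambda>y. g y * sqrt (1 - y\<^sup>2)) else 0)"
proof -
  let ?f = "\<lambda>x y. q_poly N a (int r) x y * x ^ k * g y"
  \<comment> \<open>The factor \<open>4 / pi^2\<close> of the weight times the moment
    \<open>pi / 2^(r+1)\<close>.\<close>
  define v where "v = (if k = r then 2 / (pi * 2 ^ r) else 0)"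
  have fc: "cont2 ?f"
    using continuous_on_compose2[OF g continuous_on_snd[OF continuous_on_id], of UNIV]
    by (intro continuous_intros cont2_q_poly) auto
  have "(LINT x:{-1..1}|lborel. ?f x y * weight N a x y) = v * (g y * sqrt (1 - y\<^sup>2))" if y: "y \<in> {-1..1}" for y
  proof -
    define w where "w = Complex y (sqrt (1 - y\<^sup>2))"
    have w: "cmod w = 1" using y unit_semicircle_norm by (simp add: w_def)
    then have w0: "w \<noteq> 0" by auto
    have wy: "(w + 1 / w) / 2 = of_real y"
      using w by (simp add: unit_circle_inverse complex_eq_iff) (simp add: w_def)
    have cp: "cpoly p (of_real x) = of_real (poly p x)" for p x
      by (induction p) (simp_all add: cpoly_pCons)
    define H where "H z = (\<Sum>i\<le>2*N. of_real (poly (h_coeff N a i) y) * z ^ i)" for z :: complex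
    have H: "H z = omega N a z w * omega N a z (1 / w)" for z
      by (simp only: h_coeff_expansion(2)[OF w0] wy cp atLeast0AtMost H_def)
    have nz: "H z \<noteq> 0" if "cmod z \<le> 1" for z
      unfolding H using omega_nonzero[of N a z w] omega_nonzero[of N a z "1 / w"] a that w by (simp add: norm_divide)
    have "H 0 = (\<Sum>i\<le>2*N. if i = 0 then of_real (poly (h_coeff N a 0) y) else 0)"
      unfolding H_def by (intro sum.cong refl) auto
    moreover have "H 0 = 1" unfolding H by (simp add: omega_def)
    ultimately have h0: "poly (h_coeff N a 0) y = 1" by simp
    have "((\<lambda>x. (\<Sum>i\<le>2*N. poly (h_coeff N a i) y * cheb_U (int r - int i) x) * x ^ k * sqrt (1 - x\<^sup>2)
            / (cmod (H (Complex x (sqrt (1 - x\<^sup>2)))))\<^sup>2)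
          has_integral (if k = r then pi / 2 ^ (r + 1) else 0)) {-1..1}"
      unfolding H_def by (rule cheb_combination_integral) (use h0 nz k in \<open>auto simp: H_def\<close>)
    then have "((\<lambda>x. (4 / pi\<^sup>2 * (g y * sqrt (1 - y\<^sup>2))) *
           ((\<Sum>i\<le>2*N. poly (h_coeff N a i) y * cheb_U (int r - int i) x) * x ^ k * sqrt (1 - x\<^sup>2)
            / (cmod (H (Complex x (sqrt (1 - x\<^sup>2)))))\<^sup>2))
          has_integral (4 / pi\<^sup>2 * (g y * sqrt (1 - y\<^sup>2))) * (if k = r then pi / 2 ^ (r + 1) else 0)) {-1..1}"
      by (rule has_integral_mult_right)
    moreover have "(4 / pi\<^sup>2 * (g y * sqrt (1 - y\<^sup>2))) *
           ((\<Sum>i\<le>2*N. poly (h_coeff N a i) y * cheb_U (int r - int i) x) * x ^ k * sqrt (1 - x\<^sup>2)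
            / (cmod (H (Complex x (sqrt (1 - x\<^sup>2)))))\<^sup>2) = ?f x y * weight N a x y" for x
      unfolding weight_def Let_def q_poly_def H w_def[symmetric] atLeast0AtMost by simp
    moreover have "(4 / pi\<^sup>2 * (g y * sqrt (1 - y\<^sup>2))) * (if k = r then pi / 2 ^ (r + 1) else 0) = v * (g y * sqrt (1 - y\<^sup>2))"
      by (simp add: v_def power2_eq_square)
    ultimately have hi: "((\<lambda>x. ?f x y * weight N a x y) has_integral (v * (g y * sqrt (1 - y\<^sup>2)))) {-1..1}"
      by simp
    have c1: "continuous_on {-1..1} (\<lambda>x. weight N a x y)"
    proof -
      have "continuous_on {-1..1} (\<lambda>x. (x, y))" by (intro continuous_intros)
      moreover have "(\<lambda>x. (x, y)) ` {-1..1} \<subseteq> square" using y by auto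
      ultimately show ?thesis using continuous_on_compose2[OF weight_continuous[OF a]] by fastforce
    qed
    have c2: "continuous_on {-1..1} (\<lambda>x. ?f x y)"
    proof -
      have "continuous_on {-1..1} (\<lambda>x. (x, y))" by (intro continuous_intros)
      from continuous_on_compose2[OF fc this] show ?thesis by auto
    qed
    have "set_integrable lborel {-1..1} (\<lambda>x. ?f x y * weight N a x y)"
      unfolding set_integrable_def by (intro borel_integrable_compact continuous_on_mult c1 c2) auto
    then show ?thesis
      using hi by (simp add: set_borel_integral_eq_integral(2) integral_unique)
  qed
  note inner = this
  have "weight_integral N a ?f = (LINT y:{-1..1}|lborel. LINT x:{-1..1}|lborel. ?f x y * weight N a x y)"
    by (rule weight_integral_iterated(1)[OF a fc])
  also have "\<dots> = (LINT y:{-1..1}|lborel. v * (g y * sqrt (1 - y\<^sup>2)))"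
    by (intro set_lebesgue_integral_cong allI impI inner) auto
  also have "\<dots> = integral {-1..1} (\<lambda>y. v * (g y * sqrt (1 - y\<^sup>2)))"
    by (rule set_borel_integral_eq_integral(2)) (unfold set_integrable_def,
      intro borel_integrable_compact continuous_intros continuous_on_subset[OF g], auto)
  also have "\<dots> = v * integral {-1..1} (\<lambda>y. g y * sqrt (1 - y\<^sup>2))" by simp
  finally show ?thesis by (simp add: v_def)
qed

lemma weight_integral_qt_poly:
  assumes a: "\<And>i. i \<in> {1..N} \<Longrightarrow> \<bar>a i\<bar> < 1" and k: "k \<le> t" and g: "continuous_on UNIV g"
  shows "weight_integral N a (\<lambda>x y. qt_poly N a (int t) x y * y ^ k * g x) =
    (if k = t then 2 / (pi * 2 ^ t) * integral {-1..1} (\<lambda>x. g x * sqrt (1 - x\<^sup>2)) else 0)"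
proof -
  have fc: "cont2 (\<lambda>x y. q_poly N a (int t) x y * x ^ k * g y)"
    using continuous_on_compose2[OF g continuous_on_snd[OF continuous_on_id], of UNIV]
    by (intro continuous_intros cont2_q_poly) auto
  have "weight_integral N a (\<lambda>x y. qt_poly N a (int t) x y * y ^ k * g x) =
        weight_integral N a (\<lambda>x y. q_poly N a (int t) x y * x ^ k * g y)"
    unfolding qt_poly_eq_q_poly by (rule weight_integral_swap[OF a fc])
  then show ?thesis using weight_integral_q_poly[OF a k g] by simp
qed

section \<open>Definiteness of the inner product\<close>

lemma eval2_eq_0_imp:
  assumes "\<And>x y. x \<in> {-1<..<1} \<Longrightarrow> y \<in> {-1<..<1} \<Longrightarrow> eval2 p x y = 0"
  shows "p = 0"
proof -
  have inf: "infinite {-1<..<1::real}" by simp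
  have "poly p [:y:] = 0" if "y \<in> {-1<..<1}" for y
  proof (rule ccontr)
    assume "poly p [:y:] \<noteq> 0"
    then have "finite {x. poly (poly p [:y:]) x = 0}" by (rule poly_roots_finite)
    moreover have "{-1<..<1} \<subseteq> {x. poly (poly p [:y:]) x = 0}"
      using assms that by (auto simp: eval2_def)
    ultimately show False using inf finite_subset by blast
  qed
  then have sub: "(\<lambda>y. [:y:]) ` {-1<..<1} \<subseteq> {c. poly p c = 0}" by auto
  have "infinite ((\<lambda>y::real. [:y:]) ` {-1<..<1})"
    using inf by (subst finite_image_iff) (auto simp: inj_on_def)
  then show ?thesis using sub poly_roots_finite finite_subset by blast
qed

text \<open>A continuous nonnegative integrand with integral zero vanishes on the square. The weight
  is zero on the boundary, so the vanishing of \<open>p\<close> is read off in the open square,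
  which suffices for a polynomial.\<close>

lemma weight_integral_definite:
  assumes a: "\<And>i. i \<in> {1..N} \<Longrightarrow> \<bar>a i\<bar> < 1" and "weight_integral N a (\<lambda>x y. (eval2 p x y)\<^sup>2) = 0"
  shows "p = 0"
proof (rule eval2_eq_0_imp)
  let ?F = "\<lambda>v. (eval2 p (fst v) (snd v))\<^sup>2 * weight N a (fst v) (snd v)"
  have sq: "square = cbox (-1, -1) (1, 1)" by (simp add: cbox_Pair_eq)
  have pc: "cont2 (\<lambda>x y. (eval2 p x y)\<^sup>2)" by (intro continuous_intros cont2_eval2)
  have "integral square ?F = 0"
    using assms(2) set_integrable_weight[OF a pc]
    by (simp add: weight_integral_alt set_borel_integral_eq_integral(2))
  moreover have "continuous_on square ?F"
    by (intro continuous_on_mult continuous_on_subset[OF pc] weight_continuous[OF a]) auto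
  moreover have "box (-1, -1) (1, 1) \<noteq> ({} :: (real \<times> real) set)"
    by (auto simp: box_ne_empty Basis_prod_def)
  ultimately have "\<forall>v\<in>square. ?F v = 0"
    unfolding sq by (subst (asm) integral_cbox_eq_0_iff) (auto simp: cbox_Pair_eq weight_nonneg)
  then show "eval2 p x y = 0" if "x \<in> {-1<..<1}" "y \<in> {-1<..<1}" for x y
    using that weight_pos[OF a that] by fastforce
qed

section \<open>The representation\<close>

text \<open>The product \<open>u(x) v(y)\<close> as an element of R[x][y].\<close>

definition outer_poly :: "real poly \<Rightarrow> real poly \<Rightarrow> poly2" where
  "outer_poly u v = map_poly (\<lambda>c. smult c u) v"

lemma coeff2_outer_poly: "coeff2 (outer_poly u v) i j = coeff u i * coeff v j"
  by (simp add: coeff2_def outer_poly_def coeff_map_poly)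

lemma eval2_outer_poly: "eval2 (outer_poly u v) x y = poly u x * poly v y"
proof (induction v)
  case 0
  then show ?case by (simp add: outer_poly_def eval2_0)
next
  case (pCons c v)
  have "outer_poly u (pCons c v) = pCons (smult c u) (outer_poly u v)"
    unfolding outer_poly_def by (rule map_poly_pCons) simp
  then show ?case using pCons by (simp add: eval2_pCons algebra_simps)
qed

lemma eval2_diff: "eval2 (p - q) x y = eval2 p x y - eval2 q x y"
  and eval2_smult: "eval2 (smult [:c:] p) x y = c * eval2 p x y"
  and eval2_sum: "eval2 (\<Sum>s\<in>S. f s) x y = (\<Sum>s\<in>S. eval2 (f s) x y)"
  by (simp_all add: eval2_def poly_sum)

lemma coeff2_diff: "coeff2 (p - q) i j = coeff2 p i j - coeff2 q i j"
  and coeff2_smult: "coeff2 (smult [:c:] p) i j = c * coeff2 p i j"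
  and coeff2_sum: "coeff2 (\<Sum>s\<in>S. f s) i j = (\<Sum>s\<in>S. coeff2 (f s) i j)"
  by (simp_all add: coeff2_def coeff_sum)

lemma weight_integral_mult_eval2:
  assumes a: "\<And>i. i \<in> {1..N} \<Longrightarrow> \<bar>a i\<bar> < 1" and F: "cont2 F" and D: "D \<in> Pi_nm n m"
  shows "weight_integral N a (\<lambda>x y. F x y * eval2 D x y) =
    (\<Sum>j\<le>m. \<Sum>i\<le>n. coeff2 D i j * weight_integral N a (\<lambda>x y. F x y * (x ^ i * y ^ j)))"
proof -
  have "(\<lambda>x y. F x y * eval2 D x y) = (\<lambda>x y. \<Sum>j\<le>m. \<Sum>i\<le>n. coeff2 D i j * (F x y * (x ^ i * y ^ j)))"
    unfolding eval2_coeff2[OF D] sum_distrib_left by (simp add: mult_ac)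
  then have "weight_integral N a (\<lambda>x y. F x y * eval2 D x y) =
     weight_integral N a (\<lambda>x y. \<Sum>j\<le>m. \<Sum>i\<le>n. coeff2 D i j * (F x y * (x ^ i * y ^ j)))" by simp
  also have "\<dots> = (\<Sum>j\<le>m. weight_integral N a (\<lambda>x y. \<Sum>i\<le>n. coeff2 D i j * (F x y * (x ^ i * y ^ j))))"
    by (intro weight_integral_sum a continuous_intros F)
  also have "\<dots> = (\<Sum>j\<le>m. \<Sum>i\<le>n. weight_integral N a (\<lambda>x y. coeff2 D i j * (F x y * (x ^ i * y ^ j))))"
    by (intro sum.cong refl weight_integral_sum a continuous_intros F)
  finally show ?thesis by (simp only: weight_integral_cmult)
qed

text \<open>What the sum in the theorem becomes once the linear system has removed the unwanted
  terms. The truncated subtractions are harmless for \<open>N \<le> l\<close> and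
  \<open>N + d \<le> t\<close>.\<close>

definition cheb_product_sum :: "nat \<Rightarrow> (nat \<Rightarrow> real) \<Rightarrow> (nat \<Rightarrow> real) \<Rightarrow> nat \<Rightarrow> nat \<Rightarrow> nat \<Rightarrow> poly2" where
  "cheb_product_sum N a g d l t = (\<Sum>b\<le>N. \<Sum>m\<le>d. smult [:coeff (phi N a) b * g m:]
     (outer_poly (cheb_poly (l + m - b)) (cheb_poly (t - b - m))))"

lemma coeff2_cheb_product_sum:
  "coeff2 (cheb_product_sum N a g d l t) i j = (\<Sum>b\<le>N. \<Sum>m\<le>d. coeff (phi N a) b * g m *
     (coeff (cheb_poly (l + m - b)) i * coeff (cheb_poly (t - b - m)) j))"
  by (simp add: cheb_product_sum_def coeff2_sum coeff2_smult coeff2_outer_poly)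

lemma coeff2_cheb_product_sum_nonzero:
  assumes "coeff2 (cheb_product_sum N a g d l t) i j \<noteq> 0"
  obtains b m where "b \<le> N" "m \<le> d" "g m \<noteq> 0" "i \<le> l + m - b" "j \<le> t - b - m"
proof -
  obtain b where b: "b \<le> N" "(\<Sum>m\<le>d. coeff (phi N a) b * g m *
     (coeff (cheb_poly (l + m - b)) i * coeff (cheb_poly (t - b - m)) j)) \<noteq> 0"
    using assms unfolding coeff2_cheb_product_sum by (meson atMost_iff sum.neutral)
  then obtain m where "m \<le> d" "coeff (phi N a) b * g m *
     (coeff (cheb_poly (l + m - b)) i * coeff (cheb_poly (t - b - m)) j) \<noteq> 0"
    by (meson atMost_iff sum.neutral)
  then show ?thesis using b(1) coeff_cheb_poly_above[of "l + m - b" i] coeff_cheb_poly_above[of "t - b - m" j]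
    by (intro that[of b m]) (auto simp: not_less[symmetric])
qed

text \<open>Only \<open>b + m \<le> m0\<close> reaches the power \<open>t - m0\<close> of
  \<open>y\<close>, and \<open>g m = 0\<close> for \<open>m < m0\<close> leaves
  \<open>b = 0\<close>, \<open>m = m0\<close>. The case \<open>m0 = 0\<close> gives the coefficient
  at \<open>(l, t)\<close>; the least \<open>m0\<close> with \<open>g m0 \<noteq> 0\<close> shows
  that the polynomial is not zero.\<close>

lemma coeff2_cheb_product_sum_top:
  assumes t: "N + d \<le> t" and m0: "m0 \<le> d" and z: "\<And>m. m < m0 \<Longrightarrow> g m = 0"
  shows "coeff2 (cheb_product_sum N a g d l t) (l + m0) (t - m0) = g m0 * 2 ^ (l + t)"
proof -
  have *: "coeff (phi N a) b * g m * (coeff (cheb_poly (l + m - b)) (l + m0) * coeff (cheb_poly (t - b - m)) (t - m0))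
      = (if b = 0 then if m = m0 then g m0 * 2 ^ (l + t) else 0 else 0)" if "b \<le> N" "m \<le> d" for b m
  proof -
    consider "m < m0" | "b = 0" "m = m0" | "m0 < b + m" by linarith
    then show ?thesis
    proof cases
      case 2
      then have "(2::real) ^ (l + m0) * 2 ^ (t - m0) = 2 ^ (l + t)"
        using m0 t by (simp flip: power_add)
      with 2 show ?thesis by (simp add: coeff_phi_0 coeff_cheb_poly_top)
    next
      case 3
      then have "t - b - m < t - m0" using t that m0 by linarith
      then show ?thesis using 3 by (auto simp: coeff_cheb_poly_above)
    qed (use z in auto)
  qed
  have "coeff2 (cheb_product_sum N a g d l t) (l + m0) (t - m0) =
      (\<Sum>b\<le>N. \<Sum>m\<le>d. if b = 0 then if m = m0 then g m0 * 2 ^ (l + t) else 0 else 0)"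
    unfolding coeff2_cheb_product_sum by (intro sum.cong refl *) auto
  also have "\<dots> = (\<Sum>b\<le>N. if b = 0 then g m0 * 2 ^ (l + t) else 0)"
    using m0 by (intro sum.cong refl) auto
  finally show ?thesis by simp
qed

lemma eval2_cheb_product_sum:
  assumes "N \<le> l" "N + d \<le> t"
  shows "eval2 (cheb_product_sum N a g d l t) x y = (\<Sum>b\<le>N. \<Sum>m\<le>d. coeff (phi N a) b * g m *
     (cheb_U (int l - int b + int m) x * cheb_U (int t - int b - int m) y))"
  unfolding cheb_product_sum_def eval2_sum eval2_smult eval2_outer_poly poly_cheb_poly
proof (intro sum.cong refl arg_cong2[where f = "(*)"])
  fix b m assume "b \<in> {..N}" "m \<in> {..d}"
  then have *: "int l - int b + int m = int (l + m - b)" "int t - int b - int m = int (t - b - m)"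
    using assms by auto
  have cheb_U_int: "cheb_U (int e) r = cheb_U_nat e r" for e r by (simp add: cheb_U_def)
  show "cheb_U_nat (l + m - b) x = cheb_U (int l - int b + int m) x"
    and "cheb_U_nat (t - b - m) y = cheb_U (int t - int b - int m) y"
    unfolding * cheb_U_int by (rule refl)+
qed

text \<open>After expanding the products, fix the index \<open>c\<close> that lowers both Chebyshev
  indices. What remains is the linear system with \<open>U_(l-c+e)(x) U_(t-c-e)(y)\<close> in place
  of \<open>s^e\<close>, so \<open>sys\<close> applies for each \<open>c\<close> separately.\<close>

lemma cheb_product_sum_representation:
  assumes sys: "\<And>V :: int \<Rightarrow> real.
      (\<Sum>j<k. A j * (\<Sum>b\<le>N. coeff (phi N a) b * V (int b - int j))
             + B j * (\<Sum>b\<le>N. coeff (phi N a) b * V (int d + 1 + int j - int b)))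
      = (\<Sum>m\<le>d. g m * V (int m))"
    and "N \<le> l" "N + d \<le> t"
  shows "eval2 (cheb_product_sum N a g d l t) x y =
    (\<Sum>j<k. A j * (qt_poly N a (int t + int j) x y * cheb_U (int l - int j) x)
           + B j * (q_poly N a (int l + int d + 1 + int j) x y * cheb_U (int t - int d - 1 - int j) y))"
proof -
  let ?c = "\<lambda>b. coeff (phi N a) b"
  define V where "V c e = cheb_U (int l - int c + e) x * cheb_U (int t - int c - e) y" for c e
  have A: "qt_poly N a (int t + int j) x y * cheb_U (int l - int j) x =
      (\<Sum>c\<le>N. ?c c * (\<Sum>b\<le>N. ?c b * V c (int b - int j)))" for j
    unfolding qt_poly_eq_q_poly q_poly_mult_cheb_U V_def sum_distrib_left
    by (subst sum.swap) (simp add: algebra_simps)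
  have B: "q_poly N a (int l + int d + 1 + int j) x y * cheb_U (int t - int d - 1 - int j) y =
      (\<Sum>c\<le>N. ?c c * (\<Sum>b\<le>N. ?c b * V c (int d + 1 + int j - int b)))" for j
    unfolding q_poly_mult_cheb_U V_def sum_distrib_left
    by (subst sum.swap) (simp add: algebra_simps)
  have combine: "\<alpha> * (\<Sum>c\<in>S. u c * P c) + \<beta> * (\<Sum>c\<in>S. u c * Q c) = (\<Sum>c\<in>S. u c * (\<alpha> * P c + \<beta> * Q c))"
    for \<alpha> \<beta> :: real and u P Q :: "nat \<Rightarrow> real" and S
    by (simp add: sum_distrib_left sum.distrib algebra_simps)
  have "(\<Sum>j<k. A j * (qt_poly N a (int t + int j) x y * cheb_U (int l - int j) x)
           + B j * (q_poly N a (int l + int d + 1 + int j) x y * cheb_U (int t - int d - 1 - int j) y))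
     = (\<Sum>j<k. \<Sum>c\<le>N. ?c c * (A j * (\<Sum>b\<le>N. ?c b * V c (int b - int j))
             + B j * (\<Sum>b\<le>N. ?c b * V c (int d + 1 + int j - int b))))"
    unfolding A B by (intro sum.cong refl combine)
  also have "\<dots> = (\<Sum>c\<le>N. ?c c * (\<Sum>j<k. A j * (\<Sum>b\<le>N. ?c b * V c (int b - int j))
             + B j * (\<Sum>b\<le>N. ?c b * V c (int d + 1 + int j - int b))))"
    unfolding sum_distrib_left[of "?c _" _ "{..<k}"] by (rule sum.swap)
  also have "\<dots> = (\<Sum>c\<le>N. ?c c * (\<Sum>m\<le>d. g m * V c (int m)))"
    unfolding sys ..
  also have "\<dots> = eval2 (cheb_product_sum N a g d l t) x y"
    unfolding eval2_cheb_product_sum[OF assms(2,3)] V_def sum_distrib_left by (simp only: mult.assoc)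
  finally show ?thesis by simp
qed

text \<open>The terms with \<open>q_poly\<close> vanish because \<open>i \<le> l + d\<close> is
  below their index, those with \<open>qt_poly\<close> of index \<open>t + s\<close>,
  \<open>s > 0\<close>, because \<open>j \<le> t\<close>. Only \<open>s = 0\<close> with
  \<open>j = t\<close> remains; there \<open>i \<le> l\<close>, and the Chebyshev moment selects
  \<open>i = l\<close>.\<close>

lemma cheb_product_sum_moment:
  assumes a: "\<And>i. i \<in> {1..N} \<Longrightarrow> \<bar>a i\<bar> < 1"
    and sys: "\<And>V :: int \<Rightarrow> real.
      (\<Sum>j<k. A j * (\<Sum>b\<le>N. coeff (phi N a) b * V (int b - int j))
             + B j * (\<Sum>b\<le>N. coeff (phi N a) b * V (int d + 1 + int j - int b)))
      = (\<Sum>m\<le>d. g m * V (int m))"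
    and "N \<le> l" "N + d \<le> t" and k: "0 < k"
    and i: "i \<le> l + d" and j: "j \<le> t" and ij: "j = t \<Longrightarrow> i \<le> l"
  shows "weight_integral N a (\<lambda>x y. eval2 (cheb_product_sum N a g d l t) x y * (x ^ i * y ^ j)) =
    (if i = l \<and> j = t then A 0 / 2 ^ (l + t) else 0)"
proof -
  let ?X = "\<lambda>s x y. qt_poly N a (int (t + s)) x y * y ^ j * (cheb_U (int l - int s) x * x ^ i)"
  let ?Y = "\<lambda>s x y. q_poly N a (int (l + d + 1 + s)) x y * x ^ i * (cheb_U (int t - int d - 1 - int s) y * y ^ j)"
  have cc: "continuous_on UNIV (\<lambda>x. cheb_U e x * x ^ n)" for e n
  proof -
    obtain u where "\<And>x. cheb_U e x = poly u x" using cheb_U_poly_ex by metis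
    then show ?thesis by (auto intro!: continuous_intros)
  qed
  have cX: "cont2 (?X s)" and cY: "cont2 (?Y s)" for s
    by (intro continuous_intros cont2_qt_poly cont2_q_poly cont2_cheb_U_x cont2_cheb_U_y)+
  have X: "weight_integral N a (?X s) = (if s = 0 then if i = l \<and> j = t then 1 / 2 ^ (l + t) else 0 else 0)" for s
  proof -
    have "weight_integral N a (?X s) = (if j = t + s then 2 / (pi * 2 ^ (t + s)) *
        integral {-1..1} (\<lambda>x. cheb_U (int l - int s) x * x ^ i * sqrt (1 - x\<^sup>2)) else 0)"
      by (rule weight_integral_qt_poly) (use a j cc in auto)
    moreover have "2 / (pi * 2 ^ t) * integral {-1..1} (\<lambda>x. cheb_U (int l) x * x ^ i * sqrt (1 - x\<^sup>2)) =
        (if i = l then 1 / 2 ^ (l + t) else 0)" if "j = t"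
      using integral_unique[OF cheb_U_moment[OF ij[OF that]]] by (simp add: power_add)
    ultimately show ?thesis using j by auto
  qed
  have Y: "weight_integral N a (?Y s) = 0" for s
    by (subst weight_integral_q_poly) (use a i cc in auto)
  have "(\<lambda>x y. eval2 (cheb_product_sum N a g d l t) x y * (x ^ i * y ^ j)) =
      (\<lambda>x y. \<Sum>s<k. A s * ?X s x y + B s * ?Y s x y)"
    unfolding cheb_product_sum_representation[OF sys assms(3,4)] sum_distrib_right
    by (intro ext sum.cong refl) (simp add: algebra_simps)
  then have "weight_integral N a (\<lambda>x y. eval2 (cheb_product_sum N a g d l t) x y * (x ^ i * y ^ j)) =
      weight_integral N a (\<lambda>x y. \<Sum>s<k. A s * ?X s x y + B s * ?Y s x y)" by simp
  also have "\<dots> = (\<Sum>s<k. weight_integral N a (\<lambda>x y. A s * ?X s x y + B s * ?Y s x y))"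
    by (intro weight_integral_sum a continuous_on_add continuous_on_mult continuous_on_const cX cY)
  also have "\<dots> = (\<Sum>s<k. A s * weight_integral N a (?X s) + B s * weight_integral N a (?Y s))"
    by (intro sum.cong refl, subst weight_integral_add)
       (auto simp only: weight_integral_cmult intro!: a continuous_on_add continuous_on_mult continuous_on_const cX cY)
  also have "\<dots> = (\<Sum>s<k. if s = 0 then A 0 * (if i = l \<and> j = t then 1 / 2 ^ (l + t) else 0) else 0)"
    unfolding X Y by (intro sum.cong refl) auto
  also have "\<dots> = (if i = l \<and> j = t then A 0 / 2 ^ (l + t) else 0)"
    using k by simp
  finally show ?thesis .
qed

text \<open>The constants are obtained before \<open>n\<close>, \<open>m\<close>, \<open>t\<close>,
  \<open>l\<close> and \<open>p\<close> are introduced. Identification with \<open>p\<close> rests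
  on uniqueness: two polynomials with the same top monomial, both orthogonal to all lower ones, are
  proportional.\<close>

lemma ptilde_representation:
  assumes a: "\<And>i. i \<in> {1..N} \<Longrightarrow> 0 < \<bar>a i\<bar> \<and> \<bar>a i\<bar> < 1" and d: "d < N" and k: "k = N - d"
  obtains A B :: "nat \<Rightarrow> real" where "\<And>n m t l p x y.
    n \<ge> 2 * N \<Longrightarrow> t \<ge> 2 * N \<Longrightarrow> m \<ge> t \<Longrightarrow> n = l + d \<Longrightarrow> is_ptilde N a n m l t p \<Longrightarrow>
    eval2 p x y = (\<Sum>j<k. A j * (qt_poly N a (int t + int j) x y * cheb_U (int l - int j) x)
           + B j * (q_poly N a (int l + int d + 1 + int j) x y * cheb_U (int t - int d - 1 - int j) y))"
proof -
  have a1: "\<And>i. i \<in> {1..N} \<Longrightarrow> \<bar>a i\<bar> < 1" using a by blast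
  obtain A B g :: "nat \<Rightarrow> real" where g: "\<exists>m\<le>d. g m \<noteq> 0"
    and sys: "\<And>V :: int \<Rightarrow> real.
      (\<Sum>j<k. A j * (\<Sum>b\<le>N. coeff (phi N a) b * V (int b - int j))
             + B j * (\<Sum>b\<le>N. coeff (phi N a) b * V (int d + 1 + int j - int b)))
      = (\<Sum>m\<le>d. g m * V (int m))"
    by (rule coefficient_system[OF _ d k]) (rule a, assumption, rule that)
  \<comment> \<open>Division by the norm \<open>sqrt (g 0 * A 0)\<close>; the sign makes the leading
    coefficient positive.\<close>
  define \<kappa> where "\<kappa> = sgn (g 0) / sqrt (g 0 * A 0)"
  show ?thesis
  proof (rule that[of "\<lambda>j. \<kappa> * A j" "\<lambda>j. \<kappa> * B j"])
    fix n m t l p x y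
    assume nt: "n \<ge> 2 * N" "t \<ge> 2 * N" "m \<ge> t" and n: "n = l + d" and pt: "is_ptilde N a n m l t p"
    define P where "P = cheb_product_sum N a g d l t"
    define \<alpha> where "\<alpha> = coeff2 p l t"
    define \<gamma> where "\<gamma> = g 0 * 2 ^ (l + t)"
    have lt: "N \<le> l" "N + d \<le> t" using nt n d by auto
    have p: "p \<in> Pi_nm n m" "\<alpha> > 0" "weight_integral N a (\<lambda>x y. (eval2 p x y)\<^sup>2) = 1"
      and p_lower: "\<And>i j. coeff2 p i j \<noteq> 0 \<Longrightarrow> (i, j) = (l, t) \<or> revlex_less (i, j) (l, t)"
      and p_orth: "\<And>i j. i \<le> n \<Longrightarrow> j \<le> m \<Longrightarrow> revlex_less (i, j) (l, t) \<Longrightarrow>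
         weight_integral N a (\<lambda>x y. eval2 p x y * (x ^ i * y ^ j)) = 0"
      using pt unfolding is_ptilde_def has_revlex_degree_def \<alpha>_def by auto
    have P_mom: "weight_integral N a (\<lambda>x y. eval2 P x y * (x ^ i * y ^ j)) =
        (if i = l \<and> j = t then A 0 / 2 ^ (l + t) else 0)"
      if "i \<le> n" "(i, j) = (l, t) \<or> revlex_less (i, j) (l, t)" for i j
      unfolding P_def by (rule cheb_product_sum_moment[OF a1 sys lt])
        (use that n d k in \<open>auto simp: revlex_less_def\<close>)
    have P_lower: "i \<le> n \<and> j \<le> t \<and> ((i, j) = (l, t) \<or> revlex_less (i, j) (l, t))"
      if "coeff2 P i j \<noteq> 0" for i j
      using that unfolding P_def
      by (elim coeff2_cheb_product_sum_nonzero) (use lt n in \<open>auto simp: revlex_less_def\<close>)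
    have P_in: "P \<in> Pi_nm n m"
      unfolding Pi_nm_def mem_Collect_eq
    proof (intro allI impI)
      fix i j assume "coeff2 P i j \<noteq> 0"
      from P_lower[OF this] show "i \<le> n \<and> j \<le> m" using nt(3) by simp
    qed
    have P_top: "coeff2 P l t = \<gamma>"
      using coeff2_cheb_product_sum_top[of N d t 0 g a l] lt by (simp add: P_def \<gamma>_def)
    have "P \<noteq> 0"
    proof -
      define m0 where "m0 = (LEAST m. g m \<noteq> 0)"
      obtain m1 where m1: "m1 \<le> d" "g m1 \<noteq> 0" using g by blast
      have "g m0 \<noteq> 0" unfolding m0_def using m1(2) by (rule LeastI)
      moreover have "m0 \<le> d" unfolding m0_def using Least_le[of "\<lambda>m. g m \<noteq> 0", OF m1(2)] m1(1) by simp
      moreover have "g m = 0" if "m < m0" for m using not_less_Least that unfolding m0_def by blast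
      ultimately have "coeff2 P (l + m0) (t - m0) \<noteq> 0"
        unfolding P_def using lt by (subst coeff2_cheb_product_sum_top) auto
      then show ?thesis by (auto simp: coeff2_def)
    qed
    have orth: "weight_integral N a (\<lambda>x y. eval2 Q x y * eval2 D x y) = 0"
      if Q: "Q = p \<or> Q = P" and D: "D \<in> Pi_nm n m"
        and lower: "\<And>i j. coeff2 D i j \<noteq> 0 \<Longrightarrow> revlex_less (i, j) (l, t)" for Q D
    proof -
      have "coeff2 D i j * weight_integral N a (\<lambda>x y. eval2 Q x y * (x ^ i * y ^ j)) = 0" if "i \<le> n" "j \<le> m" for i j
      proof (cases "coeff2 D i j = 0")
        case False
        then have rl: "revlex_less (i, j) (l, t)" by (rule lower)
        then have "\<not> (i = l \<and> j = t)" by (auto simp: revlex_less_def)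
        then show ?thesis using Q p_orth[OF that rl] P_mom[OF that(1)] rl by auto
      qed simp
      then have "(\<Sum>j\<le>m. \<Sum>i\<le>n. coeff2 D i j * weight_integral N a (\<lambda>x y. eval2 Q x y * (x ^ i * y ^ j))) = 0"
        by (intro sum.neutral ballI) auto
      moreover have "weight_integral N a (\<lambda>x y. eval2 Q x y * eval2 D x y) =
          (\<Sum>j\<le>m. \<Sum>i\<le>n. coeff2 D i j * weight_integral N a (\<lambda>x y. eval2 Q x y * (x ^ i * y ^ j)))"
        by (rule weight_integral_mult_eval2[OF a1 cont2_eval2 D])
      ultimately show ?thesis by simp
    qed
    \<comment> \<open>One factor is expanded into monomials. By \<open>P_mom\<close> only
      \<open>(l, t)\<close> contributes, namely \<open>\<gamma> * A 0 / 2^(l+t)\<close>, where the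
      power of two cancels.\<close>
    have P_norm: "weight_integral N a (\<lambda>x y. eval2 P x y * eval2 P x y) = g 0 * A 0"
    proof -
      have "weight_integral N a (\<lambda>x y. eval2 P x y * eval2 P x y) =
          (\<Sum>j\<le>m. \<Sum>i\<le>n. coeff2 P i j * weight_integral N a (\<lambda>x y. eval2 P x y * (x ^ i * y ^ j)))"
        by (rule weight_integral_mult_eval2[OF a1 cont2_eval2 P_in])
      also have "\<dots> = (\<Sum>j\<le>m. \<Sum>i\<le>n. if j = t then if i = l then g 0 * A 0 else 0 else 0)"
      proof (intro sum.cong refl)
        fix j i assume ij: "j \<in> {..m}" "i \<in> {..n}"
        show "coeff2 P i j * weight_integral N a (\<lambda>x y. eval2 P x y * (x ^ i * y ^ j)) =
            (if j = t then if i = l then g 0 * A 0 else 0 else 0)"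
        proof (cases "coeff2 P i j = 0")
          \<comment> \<open>At \<open>(l, t)\<close> a zero coefficient means \<open>g 0 = 0\<close>
            by \<open>P_top\<close>, so both sides are zero there as well.\<close>
          case True
          then show ?thesis using P_top by (auto simp: \<gamma>_def)
        next
          case False
          then show ?thesis using P_lower[OF False] P_mom[of i j] P_top by (auto simp: \<gamma>_def)
        qed
      qed
      also have "\<dots> = (\<Sum>j\<le>m. if j = t then g 0 * A 0 else 0)"
        using n by (intro sum.cong refl) auto
      finally show ?thesis using nt by simp
    qed
    have g0: "g 0 \<noteq> 0"
    proof
      assume "g 0 = 0"
      then have "weight_integral N a (\<lambda>x y. (eval2 P x y)\<^sup>2) = 0"
        using P_norm by (simp add: power2_eq_square)
      then have "P = 0" using weight_integral_definite[of N a P] a1 by blast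
      with \<open>P \<noteq> 0\<close> show False by simp
    qed
    \<comment> \<open>\<open>D\<close> has only monomials below \<open>(l, t)\<close> and is orthogonal to them, hence vanishes.\<close>
    define D where "D = smult [:\<gamma>:] p - smult [:\<alpha>:] P"
    have D_coeff: "coeff2 D i j = \<gamma> * coeff2 p i j - \<alpha> * coeff2 P i j" for i j
      by (simp add: D_def coeff2_diff coeff2_smult)
    have D_eval: "eval2 D x y = \<gamma> * eval2 p x y - \<alpha> * eval2 P x y" for x y
      by (simp add: D_def eval2_diff eval2_smult)
    have D_in: "D \<in> Pi_nm n m"
      using p(1) P_in unfolding Pi_nm_def mem_Collect_eq D_coeff by (metis diff_zero mult_zero_right)
    have D_lower: "revlex_less (i, j) (l, t)" if "coeff2 D i j \<noteq> 0" for i j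
    proof -
      have "(i, j) \<noteq> (l, t)" using that by (auto simp: D_coeff P_top \<alpha>_def)
      moreover have "coeff2 p i j \<noteq> 0 \<or> coeff2 P i j \<noteq> 0" using that by (auto simp: D_coeff)
      ultimately show ?thesis using p_lower P_lower by blast
    qed
    have "weight_integral N a (\<lambda>x y. (eval2 D x y)\<^sup>2) =
        weight_integral N a (\<lambda>x y. \<gamma> * (eval2 p x y * eval2 D x y) + (- \<alpha>) * (eval2 P x y * eval2 D x y))"
      by (rule arg_cong[where f = "weight_integral N a"], intro ext) (simp add: D_eval power2_eq_square algebra_simps)
    also have "\<dots> = weight_integral N a (\<lambda>x y. \<gamma> * (eval2 p x y * eval2 D x y)) +
        weight_integral N a (\<lambda>x y. (- \<alpha>) * (eval2 P x y * eval2 D x y))"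
      by (rule weight_integral_add) (intro a1 continuous_intros cont2_eval2 | assumption)+
    also have "\<dots> = 0"
      unfolding weight_integral_cmult using orth[OF _ D_in D_lower] by simp
    finally have "D = 0" using weight_integral_definite[of N a D] a1 by blast
    define \<beta> where "\<beta> = \<alpha> / \<gamma>"
    have \<gamma>0: "\<gamma> \<noteq> 0" using g0 by (simp add: \<gamma>_def)
    have pP: "eval2 p x y = \<beta> * eval2 P x y" for x y
      using D_eval[of x y] \<gamma>0 \<open>D = 0\<close> by (simp add: \<beta>_def eval2_0 field_simps)
    have "1 = weight_integral N a (\<lambda>x y. \<beta>\<^sup>2 * (eval2 P x y * eval2 P x y))"
      unfolding p(3)[symmetric] pP by (simp add: power2_eq_square mult_ac)
    also have "\<dots> = \<beta>\<^sup>2 * (g 0 * A 0)" by (simp only: weight_integral_cmult P_norm)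
    finally have b2: "\<beta>\<^sup>2 * (g 0 * A 0) = 1" by simp
    \<comment> \<open>The norm fixes \<open>|\<beta>|\<close> and the positive leading coefficient
      of \<open>p\<close> fixes the sign, so \<open>\<beta>\<close> is \<open>\<kappa>\<close>,
      independent of \<open>n\<close>, \<open>t\<close> and \<open>l\<close>.\<close>
    have sb: "sgn \<beta> = sgn (g 0)" using p(2) by (simp add: \<beta>_def \<gamma>_def sgn_mult sgn_divide)
    have "g 0 * A 0 = 1 / \<beta>\<^sup>2" using b2 by (cases "\<beta> = 0") (simp_all add: field_simps)
    then have "sqrt (g 0 * A 0) = 1 / \<bar>\<beta>\<bar>" by (simp add: real_sqrt_divide)
    then have "\<kappa> = \<beta>" by (simp add: \<kappa>_def sb[symmetric] mult_sgn_abs)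
    then show "eval2 p x y = (\<Sum>j<k. \<kappa> * A j * (qt_poly N a (int t + int j) x y * cheb_U (int l - int j) x)
           + \<kappa> * B j * (q_poly N a (int l + int d + 1 + int j) x y * cheb_U (int t - int d - 1 - int j) y))"
      unfolding pP P_def cheb_product_sum_representation[OF sys lt] sum_distrib_left
      by (simp add: algebra_simps)
  qed
qed

theorem theorem3p10:
  fixes N :: nat and a :: "nat \<Rightarrow> real"
  assumes "N \<ge> 1"
    and "\<And>i. i \<in> {1..N} \<Longrightarrow> 0 < \<bar>a i\<bar> \<and> \<bar>a i\<bar> < 1"
  shows "\<exists>A B :: nat \<Rightarrow> nat \<Rightarrow> real.
    \<forall>n m t l p.
      n \<ge> 2 * N \<longrightarrow> t \<ge> 2 * N \<longrightarrow> m \<ge> t \<longrightarrow> n - N < l \<longrightarrow> l \<le> n \<longrightarrow> is_ptilde N a n m l t p \<longrightarrow>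
      (\<forall>x y. eval2 p x y =
        (\<Sum>j = 0..l - (n - N) - 1.
            A (n - l) j * qt_poly N a (int t + int j) x y * cheb_U (int l - int j) x
          + B (n - l) j * q_poly N a (int n + 1 + int j) x y * cheb_U (int t + int l - int n - 1 - int j) y))"
proof -
  \<comment> \<open>Naming the property lets choice select constants for all \<open>d < N\<close> at
    once.\<close>
  define good :: "nat \<Rightarrow> (nat \<Rightarrow> real) \<Rightarrow> (nat \<Rightarrow> real) \<Rightarrow> bool" where
    "good d A B \<longleftrightarrow> (\<forall>n m t l p x y.
      n \<ge> 2 * N \<longrightarrow> t \<ge> 2 * N \<longrightarrow> m \<ge> t \<longrightarrow> n = l + d \<longrightarrow> is_ptilde N a n m l t p \<longrightarrow>
      eval2 p x y = (\<Sum>j<N - d. A j * (qt_poly N a (int t + int j) x y * cheb_U (int l - int j) x)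
           + B j * (q_poly N a (int l + int d + 1 + int j) x y * cheb_U (int t - int d - 1 - int j) y)))" for d A B
  have "\<exists>A B. good d A B" if "d < N" for d
    unfolding good_def by (rule ptilde_representation[OF assms(2) that refl]) blast+
  then obtain A B where "\<And>d. d < N \<Longrightarrow> good d (A d) (B d)" by metis
  note AB = this[unfolded good_def, rule_format]
  show ?thesis
  proof (rule exI[of _ A], rule exI[of _ B], intro allI impI)
    fix n m t l p x y
    assume h: "2 * N \<le> n" "2 * N \<le> t" "t \<le> m" "n - N < l" "l \<le> n" "is_ptilde N a n m l t p"
    define d where "d = n - l"
    \<comment> \<open>As \<open>n \<ge> 2 * N\<close>, the difference \<open>n - N\<close> is not
      truncated, and the inclusive upper limit \<open>l - (n - N) - 1\<close> is the last of the
      \<open>N - d\<close> indices.\<close>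
    have d: "d < N" "n = l + d" "l - (n - N) - 1 = N - d - 1" using h assms(1) by (auto simp: d_def)
    have "{..<N - d} = {0..N - d - 1}" using d by auto
    then show "eval2 p x y =
        (\<Sum>j = 0..l - (n - N) - 1.
            A (n - l) j * qt_poly N a (int t + int j) x y * cheb_U (int l - int j) x
          + B (n - l) j * q_poly N a (int n + 1 + int j) x y * cheb_U (int t + int l - int n - 1 - int j) y)"
      unfolding AB[OF d(1) h(1-3) d(2) h(6)] d(3) using d(2) by (simp add: mult.assoc algebra_simps)
  qed
qed

end
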